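(* Let $\alpha>0$ and let $X_n,\ldots,X_1$ be non-negative integrable i.i.d. random variables with distribution function $F(x)=x^\alpha L(x)$ for $x>0$, where $\lim_{x\downarrow 0}L(x)$ exists and equals some $\mathcal{L}\in(0,\infty)$. Let $h(y)=\left(\frac{y}{1+\alpha y/(\alpha+1)}\right)^{1/\alpha}$ for $y\ge 0$. Then the optimal two choice value $V_n^2$ satisfies $$\lim_{n\to\infty} nF(V_n^2)=h^\alpha(b_\alpha),$$ where $b_\alpha>0$ is the unique (positive) solution $y$ of $$\int_0^y h(u)\,du+(1/\alpha-y)h(y)=0.$$
   Context: The variables are observed sequentially in the order $X_n,X_{n-1},\ldots,X_1$. A statistician who knows $F$ may choose two of them using stopping rules; $V_n^2$ denotes the infimum (optimal value) of the expectation of the smaller of the two chosen values. Equivalently, by dynamic programming, with $a\wedge b=\min\{a,b\}$ and for $x\in[0,\infty]$ (a guaranteed value): $V_1^1(x)=E[X_1\wedge x]$, $V_{n+1}^1(x)=E[X_{n+1}\wedge V_n^1(x)]$ for $n\ge1$; $V_2^2(x)=E[X_2\wedge X_1\wedge x]$, $V_{n+1}^2(x)=E[V_n^1(X_{n+1})\wedge V_n^2(x)]$ for $n\ge 2$; and $V_n^2=V_n^2(x_F)=V_n^2(\infty)$, where $x_F=\sup\{x:F(x)<1\}$. *)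

theory Defs
  imports "HOL-Probability.Probability"
begin

text \<open>
  With horizon \<open>n\<close> the variables are observed in the order \<open>X n, X (n - 1), \<dots>, X 1\<close>, so at time
  \<open>t\<close> (for \<open>1 \<le> t \<le> n\<close>) the newly observed variable is \<open>X (n + 1 - t)\<close>, and the variables known
  at time \<open>t\<close> are the \<open>X j\<close> with \<open>n - t < j \<le> n\<close>.
\<close>

definition obs_filtration :: "'a measure \<Rightarrow> (nat \<Rightarrow> 'a \<Rightarrow> real) \<Rightarrow> nat \<Rightarrow> nat \<Rightarrow> 'a measure" where
  "obs_filtration M X n t =
     sigma (space M) {X j -` B \<inter> space M | j B. j \<in> {n - t<..n} \<and> B \<in> sets borel}"

text \<open>The two choices are made at (distinct) times \<open>\<sigma> < \<tau>\<close> within the horizon.\<close>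

definition two_choice_rule ::
  "'a measure \<Rightarrow> (nat \<Rightarrow> 'a \<Rightarrow> real) \<Rightarrow> nat \<Rightarrow> ('a \<Rightarrow> nat) \<Rightarrow> ('a \<Rightarrow> nat) \<Rightarrow> bool" where
  "two_choice_rule M X n \<sigma> \<tau> \<longleftrightarrow>
     stopping_time (obs_filtration M X n) \<sigma> \<and> stopping_time (obs_filtration M X n) \<tau> \<and>
     (\<forall>\<omega>\<in>space M. 1 \<le> \<sigma> \<omega> \<and> \<sigma> \<omega> < \<tau> \<omega> \<and> \<tau> \<omega> \<le> n)"

text \<open>
  The optimal two choice value is only meaningful for \<open>n \<ge> 2\<close>: for smaller \<open>n\<close> there is no
  admissible rule and the infimum of the empty set of reals is unspecified.
\<close>

definition two_choice_value :: "'a measure \<Rightarrow> (nat \<Rightarrow> 'a \<Rightarrow> real) \<Rightarrow> nat \<Rightarrow> real" where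
  "two_choice_value M X n =
     Inf {(\<integral>\<omega>. min (X (n + 1 - \<sigma> \<omega>) \<omega>) (X (n + 1 - \<tau> \<omega>) \<omega>) \<partial>M) | \<sigma> \<tau>. two_choice_rule M X n \<sigma> \<tau>}"

definition h_fun :: "real \<Rightarrow> real \<Rightarrow> real" where
  "h_fun \<alpha> y = (y / (1 + \<alpha> * y / (\<alpha> + 1))) powr (1 / \<alpha>)"

definition b_equation :: "real \<Rightarrow> real \<Rightarrow> bool" where
  "b_equation \<alpha> y \<longleftrightarrow> integral {0..y} (h_fun \<alpha>) + (1 / \<alpha> - y) * h_fun \<alpha> y = 0"

lemma filtration_obs_filtration: "filtration (space M) (obs_filtration M X n)"
proof
  show "space (obs_filtration M X n i) = space M" for i
    unfolding obs_filtration_def by (rule space_measure_of) auto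
  show "sets (obs_filtration M X n i) \<subseteq> sets (obs_filtration M X n j)" if "i \<le> j" for i j
  proof -
    have sub: "{n - i<..n} \<subseteq> {n - j<..n}"
      using that by auto
    have "{X k -` B \<inter> space M | k B. k \<in> {n - i<..n} \<and> B \<in> sets borel}
        \<subseteq> {X k -` B \<inter> space M | k B. k \<in> {n - j<..n} \<and> B \<in> sets borel}"
      using sub by blast
    then show ?thesis
      unfolding obs_filtration_def
      by (subst (1 2) sets_measure_of) (auto intro!: sigma_sets_mono')
  qed
qed

end

theory Submission
  imports Defs "HOL-Real_Asymp.Real_Asymp"
begin

text \<open>
  Let \<open>q(x) = E[X \<and> x]\<close>. Then \<open>V\<^sub>n\<^sup>1 = q\<^sup>n\<close>, and \<open>v\<^sub>n = V\<^sub>n\<^sup>2\<close> obeys \<open>v\<^sub>n\<^sub>+\<^sub>1 = E[q\<^sup>n(X) \<and> v\<^sub>n]\<close>: along any rule the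
  optimal cost given the past has nondecreasing mean, and constant mean along the greedy rule.

  As \<open>F(x) \<sim> \<L>x\<^sup>\<alpha>\<close>, \<open>q(x)\<close> to the power \<open>-\<alpha>\<close> exceeds \<open>x\<close> to the power \<open>-\<alpha>\<close> by \<open>\<alpha>\<L>/(\<alpha>+1) + o(1)\<close>. With
  \<open>s\<^sub>n = (\<L>n) powr (-1/\<alpha>)\<close> and the threshold \<open>x\<^sub>n\<close> such that \<open>nF(x\<^sub>n) \<rightarrow> y\<close>, this gives \<open>q\<^sup>n(x\<^sub>n)/s\<^sub>n \<rightarrow> h(y)\<close> and
  \<open>(n/s\<^sub>n) E[q\<^sup>n(X); X \<le> x\<^sub>n] \<rightarrow> \<integral>\<^sub>0\<^sup>y h\<close>. Stopping at the threshold \<open>x\<^sub>n\<close> for \<open>y = b\<close> bounds \<open>w\<^sub>n = v\<^sub>n/s\<^sub>n\<close> from above by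
  a linear recursion whose fixed point is \<open>h(b)\<close>. Conversely, by concavity of \<open>u \<mapsto> E[q\<^sup>n(X) \<and> u]\<close>, while \<open>w\<^sub>n\<close> is
  below \<open>h(y)\<close> with \<open>y < b\<close> it grows by a factor \<open>1 + c/n\<close> with \<open>c\<close> tending to
  \<open>(\<integral>\<^sub>0\<^sup>y h + (1/\<alpha> - y) h(y)) / h(y) > 0\<close>.
\<close>

section \<open>Real sequences\<close>

text \<open>The harmonic series diverges, so decrements \<open>d / n\<close> exhaust any margin,
  however small \<open>d\<close> is.\<close>

lemma harmonic_descent_unbounded:
  fixes z :: "nat \<Rightarrow> real"
  assumes step: "\<And>n. n \<ge> N \<Longrightarrow> z (Suc n) \<le> z n - d / real n"
    and "d > 0"
  shows "\<exists>n\<ge>N. z n < B"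
proof (rule ccontr)
  assume "\<not> ?thesis"
  then have lb: "z n \<ge> B" if "n \<ge> N" for n
    using that by force
  have z_le: "z (N + m) \<le> z N - d * (\<Sum>i<m. 1 / real (i + N))" for m
  proof (induction m)
    case (Suc m)
    then show ?case
      using step[of "N + m"] by (simp add: algebra_simps)
  qed auto
  have bound: "(\<Sum>i<m. 1 / real (i + N)) \<le> (z N - B) / d" for m
    using z_le[of m] lb[of "N + m"] \<open>d > 0\<close> by (simp add: field_simps)
  have "summable (\<lambda>i. 1 / real (i + N))"
    by (rule bounded_imp_summable[where B = "(z N - B) / d"])
       (use bound[of "Suc _"] in \<open>auto simp: lessThan_Suc_atMost\<close>)
  then have "summable (\<lambda>i. inverse (real i))"
    by (subst summable_iff_shift[symmetric, of _ N]) (simp add: inverse_eq_divide)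
  then show False
    using not_summable_harmonic[where 'a = real] by simp
qed

text \<open>The limiting recursion has the fixed point \<open>d0 / c0\<close>. For \<open>l\<close>
  above it, \<open>w n - l\<close> has an extra drift of at most \<open>- \<delta> / n\<close> for
  large \<open>n\<close>. A value at most \<open>l\<close> then stays there, and remaining above
  \<open>l\<close> forever contradicts \<open>harmonic_descent_unbounded\<close>.\<close>

lemma eventually_le_of_contracting_recursion:
  fixes w c d :: "nat \<Rightarrow> real"
  assumes rec: "eventually (\<lambda>n. w (Suc n) \<le> (1 - c n / real n) * w n + d n / real n) sequentially"
    and c: "c \<longlonglongrightarrow> c0" and d: "d \<longlonglongrightarrow> d0" and "c0 > 0" and l: "l > d0 / c0"
  shows "eventually (\<lambda>n. w n \<le> l) sequentially"
proof -
  \<comment> \<open>Half of the limiting gap; the other half absorbs the convergence errors of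
    \<open>c\<close> and \<open>d\<close>.\<close>
  define \<delta> where "\<delta> = (c0 * l - d0) / 2"
  have "\<delta> > 0"
    using l \<open>c0 > 0\<close> by (simp add: \<delta>_def field_simps)
  have \<delta>_eq: "c0 * l - d0 = 2 * \<delta>"
    by (simp add: \<delta>_def)
  have "(\<lambda>n. d n - c n * l) \<longlonglongrightarrow> d0 - c0 * l"
    by (intro tendsto_intros c d)
  moreover have "d0 - c0 * l < - \<delta>"
    using \<open>\<delta> > 0\<close> \<delta>_eq by linarith
  ultimately have e1: "eventually (\<lambda>n. d n - c n * l < - \<delta>) sequentially"
    by (rule order_tendstoD(2))
  have e2: "eventually (\<lambda>n. 0 < c n) sequentially"
    using c \<open>c0 > 0\<close> by (rule order_tendstoD(1))
  have "(\<lambda>n. c n / real n) \<longlonglongrightarrow> 0"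
    using tendsto_mult[OF c lim_inverse_n] by (simp add: field_simps)
  then have e3: "eventually (\<lambda>n. c n / real n < 1) sequentially"
    by (rule order_tendstoD(2)) simp
  obtain N where N: "\<And>n. n \<ge> N \<Longrightarrow> w (Suc n) \<le> (1 - c n / real n) * w n + d n / real n
      \<and> d n - c n * l < - \<delta> \<and> 0 < c n \<and> c n / real n < 1 \<and> n \<ge> 1"
    using eventually_conj[OF rec eventually_conj[OF e1 eventually_conj[OF e2
        eventually_conj[OF e3 eventually_ge_at_top[of 1]]]]]
    unfolding eventually_sequentially by auto
  have step: "w (Suc n) - l \<le> (1 - c n / real n) * (w n - l) - \<delta> / real n" if "n \<ge> N" for n
  proof -
    have "(d n - c n * l) / real n \<le> - \<delta> / real n"
      using N[OF that] by (intro divide_right_mono) auto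
    then show ?thesis
      using N[OF that] by (simp add: algebra_simps diff_divide_distrib)
  qed
  have keep: "w (Suc n) \<le> l" if "n \<ge> N" "w n \<le> l" for n
  proof -
    have "(1 - c n / real n) * (w n - l) \<le> 0"
      using N[OF that(1)] that(2) by (intro mult_nonneg_nonpos) auto
    moreover have "\<delta> / real n \<ge> 0"
      using \<open>\<delta> > 0\<close> by simp
    ultimately show ?thesis
      using step[OF that(1)] by linarith
  qed
  have "\<exists>n\<ge>N. w n \<le> l"
  proof (rule ccontr)
    assume "\<not> ?thesis"
    then have gt: "w n > l" if "n \<ge> N" for n
      using that by force
    have "w (Suc n) - l \<le> (w n - l) - \<delta> / real n" if "n \<ge> N" for n
    proof -
      have "(1 - c n / real n) * (w n - l) \<le> w n - l"
        using N[OF that] gt[OF that] by (intro mult_left_le_one_le) auto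
      then show ?thesis
        using step[OF that] by (meson diff_right_mono order_trans)
    qed
    from harmonic_descent_unbounded[of N "\<lambda>n. w n - l", OF this \<open>\<delta> > 0\<close>, where B = 0]
    show False
      using gt by force
  qed
  then obtain n0 where "n0 \<ge> N" "w n0 \<le> l"
    by blast
  have "w n \<le> l" if "n \<ge> n0" for n
    using that
  proof (induction n rule: dec_induct)
    case base
    show ?case by fact
  next
    case (step n)
    then show ?case
      using keep[of n] \<open>n0 \<ge> N\<close> by simp
  qed
  then show ?thesis
    unfolding eventually_sequentially by blast
qed

text \<open>The minimum asks for growth only below \<open>l\<close>; above \<open>l\<close> the same
  bound keeps the next value at least \<open>l\<close>. Growth at rate \<open>1 / n\<close> cannot
  last below \<open>l\<close>, again by divergence of the harmonic series.\<close>

lemma eventually_ge_of_expanding_recursion: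
  fixes w c :: "nat \<Rightarrow> real"
  assumes rec: "eventually (\<lambda>n. w (Suc n) \<ge> min (w n) l * (1 + c n / real n)) sequentially"
    and pos: "eventually (\<lambda>n. w n > 0) sequentially"
    and c: "c \<longlonglongrightarrow> c0" and "c0 > 0" and "l > 0"
  shows "eventually (\<lambda>n. w n \<ge> l) sequentially"
proof -
  have e1: "eventually (\<lambda>n. c0 / 2 < c n) sequentially"
    by (rule order_tendstoD(1)[OF c]) (use \<open>c0 > 0\<close> in simp)
  obtain N where N: "\<And>n. n \<ge> N \<Longrightarrow> w (Suc n) \<ge> min (w n) l * (1 + c n / real n)
      \<and> w n > 0 \<and> c0 / 2 < c n \<and> n \<ge> 1"
    using eventually_conj[OF rec eventually_conj[OF pos eventually_conj[OF e1
        eventually_ge_at_top[of 1]]]]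
    unfolding eventually_sequentially by auto
  have step: "w (Suc n) \<ge> min (w n) l + min (w n) l * (c0 / 2) / real n" if "n \<ge> N" for n
  proof -
    have "min (w n) l * ((c0 / 2) / real n) \<le> min (w n) l * (c n / real n)"
      using N[OF that] \<open>l > 0\<close> by (intro mult_left_mono divide_right_mono) auto
    then show ?thesis
      using N[OF that] by (simp add: algebra_simps)
  qed
  have pos_inc: "min (w n) l * (c0 / 2) / real n \<ge> 0" if "n \<ge> N" for n
    using N[OF that] \<open>c0 > 0\<close> \<open>l > 0\<close> by simp
  have keep: "w (Suc n) \<ge> l" if "n \<ge> N" "w n \<ge> l" for n
    using step[OF that(1)] pos_inc[OF that(1)] that(2) by linarith
  have "\<exists>n\<ge>N. w n \<ge> l"
  proof (rule ccontr)
    assume "\<not> ?thesis"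
    then have lt: "w n < l" if "n \<ge> N" for n
      using that by force
    \<comment> \<open>Monotonicity below \<open>l\<close> turns the multiplicative growth into an
      additive one of size at least \<open>w N * (c0 / 2) / n\<close>.\<close>
    have ge: "w n \<ge> w N" if "n \<ge> N" for n
      using that
    proof (induction n rule: dec_induct)
      case (step n)
      then show ?case
        using pos_inc[of n] \<open>\<And>n. n \<ge> N \<Longrightarrow> w (Suc n) \<ge> min (w n) l + min (w n) l * (c0 / 2) / real n\<close>[of n] lt[of n]
        by linarith
    qed auto
    have "- w (Suc n) \<le> - w n - (w N * (c0 / 2)) / real n" if "n \<ge> N" for n
    proof -
      have "w N * (c0 / 2) / real n \<le> w n * (c0 / 2) / real n"
        using ge[OF that] \<open>c0 > 0\<close> by (intro divide_right_mono mult_right_mono) auto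
      then show ?thesis
        using step[OF that] lt[OF that] by (simp add: min_def)
    qed
    moreover have "w N * (c0 / 2) > 0"
      using N[of N] \<open>c0 > 0\<close> by simp
    ultimately have "\<exists>n\<ge>N. - w n < - l"
      by (rule harmonic_descent_unbounded)
    then show False
      using lt by force
  qed
  then obtain n0 where "n0 \<ge> N" "w n0 \<ge> l"
    by blast
  have "w n \<ge> l" if "n \<ge> n0" for n
    using that
  proof (induction n rule: dec_induct)
    case base
    show ?case by fact
  next
    case (step n)
    then show ?case
      using keep[of n] \<open>n0 \<ge> N\<close> by simp
  qed
  then show ?thesis
    unfolding eventually_sequentially by blast
qed

text \<open>
  Both \<open>G i\<close> and \<open>I\<close> have, up to \<open>o(1)\<close>, increments on \<open>[a, b]\<close> between \<open>h a * (b - a)\<close> and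
  \<open>h b * (b - a)\<close>, so on a partition of mesh \<open>y / K\<close> the discrepancies telescope to
  \<open>(h y - h 0) * y / K\<close>.
\<close>

lemma tendsto_of_increment_bounds:
  fixes G :: "'i \<Rightarrow> real \<Rightarrow> real" and lo up :: "'i \<Rightarrow> real \<Rightarrow> real \<Rightarrow> real"
    and I h :: "real \<Rightarrow> real"
  assumes "y \<ge> 0"
    and lo: "\<And>a b. 0 \<le> a \<Longrightarrow> a \<le> b \<Longrightarrow> b \<le> y \<Longrightarrow> \<forall>\<^sub>F i in Q. lo i a b \<le> G i b - G i a"
    and up: "\<And>a b. 0 \<le> a \<Longrightarrow> a \<le> b \<Longrightarrow> b \<le> y \<Longrightarrow> \<forall>\<^sub>F i in Q. G i b - G i a \<le> up i a b"
    and lo_lim: "\<And>a b. 0 \<le> a \<Longrightarrow> a \<le> b \<Longrightarrow> b \<le> y \<Longrightarrow> ((\<lambda>i. lo i a b) \<longlongrightarrow> h a * (b - a)) Q"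
    and up_lim: "\<And>a b. 0 \<le> a \<Longrightarrow> a \<le> b \<Longrightarrow> b \<le> y \<Longrightarrow> ((\<lambda>i. up i a b) \<longlongrightarrow> h b * (b - a)) Q"
    and I_lo: "\<And>a b. 0 \<le> a \<Longrightarrow> a \<le> b \<Longrightarrow> b \<le> y \<Longrightarrow> h a * (b - a) \<le> I b - I a"
    and I_up: "\<And>a b. 0 \<le> a \<Longrightarrow> a \<le> b \<Longrightarrow> b \<le> y \<Longrightarrow> I b - I a \<le> h b * (b - a)"
  shows "((\<lambda>i. G i y - G i 0) \<longlongrightarrow> I y - I 0) Q"
proof (rule tendstoI)
  fix e :: real
  assume "e > 0"
  \<comment> \<open>The number of pieces makes the telescoped discrepancy smaller than
    \<open>e / 2\<close>; the errors \<open>\<delta>\<close> of the \<open>K\<close> pieces add up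
    to the other half.\<close>
  define K where "K = nat \<lceil>2 * (\<bar>h y - h 0\<bar> * y) / e\<rceil> + 1"
  have "K > 0"
    by (simp add: K_def)
  have "2 * (\<bar>h y - h 0\<bar> * y) / e \<le> real (nat \<lceil>2 * (\<bar>h y - h 0\<bar> * y) / e\<rceil>)"
    by (rule real_nat_ceiling_ge)
  then have "2 * (\<bar>h y - h 0\<bar> * y) / e < real K"
    by (simp add: K_def)
  then have "2 * (\<bar>h y - h 0\<bar> * y) < e * real K"
    using \<open>e > 0\<close> by (simp add: field_simps)
  then have K: "\<bar>h y - h 0\<bar> * y / real K < e / 2"
    using \<open>K > 0\<close> by (simp add: field_simps)
  define u where "u k = real k * y / real K" for k
  have u0: "u 0 = 0" and uK: "u K = y"
    using \<open>K > 0\<close> by (auto simp: u_def)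
  have u_bounds: "0 \<le> u k" "u k \<le> u (Suc k)" "u (Suc k) - u k = y / real K" for k
    using \<open>y \<ge> 0\<close> \<open>K > 0\<close> by (auto simp: u_def field_simps)
  have u_le: "u (Suc k) \<le> y" if "k < K" for k
  proof -
    have "real (Suc k) * y \<le> real K * y"
      using that \<open>y \<ge> 0\<close> by (intro mult_right_mono) auto
    then show ?thesis
      using \<open>K > 0\<close> by (simp add: u_def field_simps)
  qed
  define \<delta> where "\<delta> = e / (2 * real K)"
  have "\<delta> > 0"
    using \<open>e > 0\<close> \<open>K > 0\<close> by (simp add: \<delta>_def)
  have piece: "\<forall>\<^sub>F i in Q. \<bar>(G i (u (Suc k)) - G i (u k)) - (I (u (Suc k)) - I (u k))\<bar>
      \<le> (h (u (Suc k)) - h (u k)) * (y / real K) + \<delta>" if "k < K" for k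
  proof -
    note prem = u_bounds(1,2)[of k] u_le[OF that]
    have l: "\<forall>\<^sub>F i in Q. lo i (u k) (u (Suc k)) > h (u k) * (u (Suc k) - u k) - \<delta>"
      by (rule order_tendstoD(1)[OF lo_lim[OF prem]]) (use \<open>\<delta> > 0\<close> in simp)
    have r: "\<forall>\<^sub>F i in Q. up i (u k) (u (Suc k)) < h (u (Suc k)) * (u (Suc k) - u k) + \<delta>"
      by (rule order_tendstoD(2)[OF up_lim[OF prem]]) (use \<open>\<delta> > 0\<close> in simp)
    show ?thesis
      using l r lo[OF prem] up[OF prem]
    proof eventually_elim
      case (elim i)
      then show ?case
        using I_lo[OF prem] I_up[OF prem] unfolding u_bounds(3) left_diff_distrib by linarith
    qed
  qed
  have "\<forall>\<^sub>F i in Q. \<forall>k\<in>{..<K}. \<bar>(G i (u (Suc k)) - G i (u k)) - (I (u (Suc k)) - I (u k))\<bar>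
      \<le> (h (u (Suc k)) - h (u k)) * (y / real K) + \<delta>"
    by (rule eventually_ball_finite) (use piece in auto)
  then show "\<forall>\<^sub>F i in Q. dist (G i y - G i 0) (I y - I 0) < e"
  proof eventually_elim
    case (elim i)
    have "(G i y - G i 0) - (I y - I 0)
        = (\<Sum>k<K. (G i (u (Suc k)) - G i (u k)) - (I (u (Suc k)) - I (u k)))"
      using sum_lessThan_telescope[of "\<lambda>k. G i (u k)" K] sum_lessThan_telescope[of "\<lambda>k. I (u k)" K]
      by (simp add: sum_subtractf u0 uK)
    also have "\<bar>\<dots>\<bar> \<le> (\<Sum>k<K. \<bar>(G i (u (Suc k)) - G i (u k)) - (I (u (Suc k)) - I (u k))\<bar>)"
      by (rule sum_abs)
    also have "\<dots> \<le> (\<Sum>k<K. (h (u (Suc k)) - h (u k)) * (y / real K) + \<delta>)"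
      by (rule sum_mono) (use elim in auto)
    also have "\<dots> = (h y - h 0) * (y / real K) + real K * \<delta>"
      using sum_lessThan_telescope[of "\<lambda>k. h (u k)" K]
      by (simp only: sum.distrib sum_distrib_right[symmetric] u0 uK) simp
    also have "\<dots> \<le> \<bar>h y - h 0\<bar> * y / real K + e / 2"
      using \<open>K > 0\<close> \<open>y \<ge> 0\<close> by (auto simp: \<delta>_def intro!: mult_right_mono divide_right_mono)
    also have "\<dots> < e"
      using K by linarith
    finally show ?case
      by (simp add: dist_real_def)
  qed
qed

section \<open>The limit function and its equation\<close>

lemma h_fun_0 [simp]: "h_fun \<alpha> 0 = 0"
  by (simp add: h_fun_def)

lemma h_fun_pos:
  assumes "\<alpha> > 0" "y > 0"
  shows "h_fun \<alpha> y > 0"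
proof -
  have "1 + \<alpha> * y / (\<alpha> + 1) > 0"
    using assms by (intro add_pos_nonneg) auto
  then show ?thesis
    using assms by (simp add: h_fun_def)
qed

lemma h_fun_nonneg: "h_fun \<alpha> y \<ge> 0"
  by (simp add: h_fun_def)

text \<open>After raising to the power \<open>- \<alpha>\<close>, \<open>h_fun\<close> is
  \<open>1 / y\<close> translated by a constant. This makes monotonicity evident and is the form in
  which the limit of the iterates of \<open>q\<close> appears.\<close>

lemma h_fun_eq:
  assumes "\<alpha> > 0" "y > 0"
  shows "h_fun \<alpha> y = (1 / y + \<alpha> / (\<alpha> + 1)) powr (- (1 / \<alpha>))"
proof -
  have "y / (1 + \<alpha> * y / (\<alpha> + 1)) = inverse (1 / y + \<alpha> / (\<alpha> + 1))"
    using assms by (simp add: field_simps)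
  moreover have "1 / y + \<alpha> / (\<alpha> + 1) > 0"
    using assms by (intro add_pos_nonneg) auto
  ultimately show ?thesis
    by (simp add: h_fun_def powr_minus inverse_powr)
qed

lemma h_fun_mono:
  assumes "\<alpha> > 0" "0 \<le> a" "a \<le> b"
  shows "h_fun \<alpha> a \<le> h_fun \<alpha> b"
proof (cases "a = 0")
  case False
  then have "0 < a" "0 < b"
    using assms by auto
  have "1 / b + \<alpha> / (\<alpha> + 1) > 0"
    using assms \<open>0 < b\<close> by (intro add_pos_nonneg) auto
  moreover have "1 / b + \<alpha> / (\<alpha> + 1) \<le> 1 / a + \<alpha> / (\<alpha> + 1)"
    using assms \<open>0 < a\<close> by (simp add: frac_le)
  ultimately show ?thesis
    using assms \<open>0 < a\<close> \<open>0 < b\<close> by (simp add: h_fun_eq powr_mono2')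
qed (simp add: h_fun_nonneg)

lemma continuous_on_h_fun:
  assumes "\<alpha> > 0"
  shows "continuous_on {0..} (h_fun \<alpha>)"
proof -
  have "1 + \<alpha> * y / (\<alpha> + 1) > 0" if "y \<ge> 0" for y
    using assms that by (intro add_pos_nonneg) auto
  then have ne: "1 + \<alpha> * y / (\<alpha> + 1) \<noteq> 0" "y / (1 + \<alpha> * y / (\<alpha> + 1)) \<ge> 0" if "y \<ge> 0" for y
    using that by (force, simp add: less_imp_le)
  show ?thesis
    unfolding h_fun_def
    by (intro continuous_on_powr' continuous_intros) (use ne assms in auto)
qed

lemma h_fun_has_real_derivative:
  assumes "\<alpha> > 0" "y > 0"
  shows "(h_fun \<alpha> has_real_derivative h_fun \<alpha> y / (\<alpha> * y * (1 + \<alpha> * y / (\<alpha> + 1)))) (at y)"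
proof -
  define c where "c = \<alpha> / (\<alpha> + 1)"
  have pos: "1 / y + c > 0"
    using assms by (auto simp: c_def intro!: add_pos_nonneg)
  have "((\<lambda>y. (1 / y + c) powr (- (1 / \<alpha>))) has_real_derivative
      (- (1 / \<alpha>)) * (1 / y + c) powr (- (1 / \<alpha>) - 1) * (- 1 / y\<^sup>2)) (at y)"
    by (rule has_real_derivative_powr[THEN DERIV_chain2])
       (use assms pos in \<open>auto intro!: derivative_eq_intros simp: power2_eq_square\<close>)
  also have "(1 / y + c) powr (- (1 / \<alpha>) - 1) = (1 / y + c) powr (- (1 / \<alpha>)) / (1 / y + c)"
    using pos by (simp add: powr_diff)
  also have "(- (1 / \<alpha>)) * ((1 / y + c) powr (- (1 / \<alpha>)) / (1 / y + c)) * (- 1 / y\<^sup>2)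
      = (1 / y + c) powr (- (1 / \<alpha>)) / (\<alpha> * y * (1 + c * y))"
    using assms pos by (simp add: field_simps power2_eq_square)
  also have "(1 / y + c) powr (- (1 / \<alpha>)) = h_fun \<alpha> y"
    using assms by (simp add: h_fun_eq c_def)
  finally have "((\<lambda>y. (1 / y + c) powr (- (1 / \<alpha>))) has_real_derivative
      h_fun \<alpha> y / (\<alpha> * y * (1 + \<alpha> * y / (\<alpha> + 1)))) (at y)"
    by (simp add: c_def)
  then show ?thesis
    by (rule has_field_derivative_transform_within_open[where S = "{0<..}"])
       (use assms in \<open>auto simp: h_fun_eq c_def\<close>)
qed

text \<open>By monotonicity of \<open>h_fun\<close>; the two bounds serve as \<open>I_lo\<close> and
  \<open>I_up\<close> in \<open>tendsto_of_increment_bounds\<close>.\<close>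

lemma integral_h_fun_increment:
  assumes "\<alpha> > 0" "0 \<le> a" "a \<le> b"
  shows "h_fun \<alpha> a * (b - a) \<le> integral {0..b} (h_fun \<alpha>) - integral {0..a} (h_fun \<alpha>)"
    and "integral {0..b} (h_fun \<alpha>) - integral {0..a} (h_fun \<alpha>) \<le> h_fun \<alpha> b * (b - a)"
proof -
  have int: "h_fun \<alpha> integrable_on {c..d}" if "0 \<le> c" for c d
    by (rule integrable_continuous_real, rule continuous_on_subset[OF continuous_on_h_fun])
       (use assms that in auto)
  have split: "integral {0..b} (h_fun \<alpha>) - integral {0..a} (h_fun \<alpha>) = integral {a..b} (h_fun \<alpha>)"
    using Henstock_Kurzweil_Integration.integral_combine[OF assms(2,3) int[of 0 b]] by simp
  have "integral {a..b} (\<lambda>_. h_fun \<alpha> a) \<le> integral {a..b} (h_fun \<alpha>)"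
    by (rule integral_le) (use assms int h_fun_mono in auto)
  then show "h_fun \<alpha> a * (b - a) \<le> integral {0..b} (h_fun \<alpha>) - integral {0..a} (h_fun \<alpha>)"
    using assms by (simp add: split mult.commute)
  have "integral {a..b} (h_fun \<alpha>) \<le> integral {a..b} (\<lambda>_. h_fun \<alpha> b)"
    by (rule integral_le) (use assms int h_fun_mono in auto)
  then show "integral {0..b} (h_fun \<alpha>) - integral {0..a} (h_fun \<alpha>) \<le> h_fun \<alpha> b * (b - a)"
    using assms by (simp add: split mult.commute)
qed

section \<open>The root of the equation for b\<close>

text \<open>Divided by \<open>h_fun \<alpha> y\<close>, this is the limiting growth rate in
  \<open>scaled_v_eventually_ge\<close>.\<close>

definition b_lhs :: "real \<Rightarrow> real \<Rightarrow> real" where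
  "b_lhs \<alpha> y = integral {0..y} (h_fun \<alpha>) + (1 / \<alpha> - y) * h_fun \<alpha> y"

lemma continuous_on_b_lhs:
  assumes "\<alpha> > 0" "0 \<le> a"
  shows "continuous_on {a..b} (b_lhs \<alpha>)"
proof -
  have h: "continuous_on {c..b} (h_fun \<alpha>)" if "c \<ge> 0" for c
    by (rule continuous_on_subset[OF continuous_on_h_fun]) (use assms that in auto)
  have "continuous_on {0..b} (\<lambda>y. integral {0..y} (h_fun \<alpha>))"
    by (intro indefinite_integral_continuous_1 integrable_continuous_real h) simp
  then have "continuous_on {a..b} (\<lambda>y. integral {0..y} (h_fun \<alpha>))"
    by (rule continuous_on_subset) (use assms in auto)
  then show ?thesis
    unfolding b_lhs_def by (intro continuous_intros h assms)
qed

text \<open>The term \<open>h_fun \<alpha> y\<close> from the fundamental theorem of calculus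
  cancels against the derivative of the factor \<open>1 / \<alpha> - y\<close>.\<close>

lemma b_lhs_has_real_derivative:
  assumes "\<alpha> > 0" "y > 0"
  shows "(b_lhs \<alpha> has_real_derivative
    (1 / \<alpha> - y) * (h_fun \<alpha> y / (\<alpha> * y * (1 + \<alpha> * y / (\<alpha> + 1))))) (at y)"
proof -
  \<comment> \<open>The fundamental theorem gives a derivative within a compact interval; ending it
    at \<open>y + 1\<close> makes \<open>y\<close> an interior point.\<close>
  have "((\<lambda>y. integral {0..y} (h_fun \<alpha>)) has_real_derivative h_fun \<alpha> y) (at y within {0..y + 1})"
    by (rule integral_has_real_derivative, rule continuous_on_subset[OF continuous_on_h_fun])
       (use assms in auto)
  moreover have "at y within {0..y + 1} = at y"
    by (rule at_within_interior) (use assms in auto)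
  ultimately have I: "((\<lambda>y. integral {0..y} (h_fun \<alpha>)) has_real_derivative h_fun \<alpha> y) (at y)"
    by simp
  show ?thesis
    unfolding b_lhs_def
    by (rule derivative_eq_intros I h_fun_has_real_derivative assms refl)+ simp
qed

text \<open>
  The derivative of \<^const>\<open>b_lhs\<close> is \<open>(1/\<alpha> - y) h'(y)\<close>: increasing up to \<open>1/\<alpha>\<close>, decreasing beyond,
  and to \<open>-\<infinity>\<close> because \<open>y h'(y)\<close> is of order \<open>1/y\<close>.
\<close>

lemma b_equation_unique_root:
  assumes "\<alpha> > 0"
  obtains b where "b > 1 / \<alpha>" "b_lhs \<alpha> b = 0" "\<And>y. 0 < y \<Longrightarrow> y < b \<Longrightarrow> b_lhs \<alpha> y > 0"
    "\<And>y. y > 0 \<Longrightarrow> b_lhs \<alpha> y = 0 \<Longrightarrow> y = b"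
proof -
  define h' where "h' y = h_fun \<alpha> y / (\<alpha> * y * (1 + \<alpha> * y / (\<alpha> + 1)))" for y
  define p where "p = 1 / \<alpha>"
  have "p > 0"
    using assms by (simp add: p_def)
  have h'_pos: "h' y > 0" if "y > 0" for y
    unfolding h'_def using assms that h_fun_pos[OF assms that]
    by (intro divide_pos_pos mult_pos_pos add_pos_nonneg) auto
  have deriv: "(b_lhs \<alpha> has_real_derivative (p - y) * h' y) (at y)" if "y > 0" for y
    using b_lhs_has_real_derivative[OF assms that] by (simp add: h'_def p_def)
  note cont = continuous_on_b_lhs[OF assms]
  have inc: "b_lhs \<alpha> x < b_lhs \<alpha> y" if "0 \<le> x" "x < y" "y \<le> p" for x y
  proof (rule DERIV_pos_imp_increasing_open[OF that(2) _ cont])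
    fix z assume z: "x < z" "z < y"
    show "\<exists>d. (b_lhs \<alpha> has_real_derivative d) (at z) \<and> 0 < d"
      using deriv[of z] h'_pos[of z] z that by (intro exI[of _ "(p - z) * h' z"]) auto
  qed (use that in auto)
  have dec: "b_lhs \<alpha> y < b_lhs \<alpha> x" if "p \<le> x" "x < y" for x y
  proof (rule DERIV_neg_imp_decreasing_open[OF that(2) _ cont])
    fix z assume z: "x < z" "z < y"
    show "\<exists>d. (b_lhs \<alpha> has_real_derivative d) (at z) \<and> d < 0"
      using deriv[of z] h'_pos[of z] z that \<open>p > 0\<close>
      by (intro exI[of _ "(p - z) * h' z"]) (auto intro!: mult_neg_pos)
  qed (use that \<open>p > 0\<close> in auto)
  have zero: "b_lhs \<alpha> 0 = 0"
    by (simp add: b_lhs_def)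
  have pos_p: "b_lhs \<alpha> y > 0" if "0 < y" "y \<le> p" for y
    using inc[of 0 y] that zero by simp
  have "\<exists>y>p. b_lhs \<alpha> y < 0"
  proof -
    \<comment> \<open>Beyond \<open>2 * p + 1\<close> both \<open>z - p \<ge> z / 2\<close> and
      \<open>z \<ge> 1\<close> hold. Together with
      \<open>h_fun \<alpha> z \<ge> h_fun \<alpha> y0\<close> they give a slope of at most
      \<open>- C / z\<close>.\<close>
    define y0 where "y0 = 2 * p + 1"
    define C where "C = h_fun \<alpha> y0 / (2 * \<alpha> * 2)"
    have "y0 > 0" "y0 > p" "y0 \<ge> 1"
      using \<open>p > 0\<close> by (auto simp: y0_def)
    have "C > 0"
      using assms h_fun_pos[OF assms \<open>y0 > 0\<close>] by (simp add: C_def)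
    have slope: "(p - z) * h' z \<le> - C / z" if "z \<ge> y0" for z
    proof -
      have "z > 0" "z \<ge> 1" "z - p \<ge> z / 2"
        using that \<open>y0 > 0\<close> \<open>y0 \<ge> 1\<close> \<open>p > 0\<close> by (auto simp: y0_def)
      have "\<alpha> * z / (\<alpha> + 1) \<le> z"
        using \<open>z > 0\<close> assms by (simp add: field_simps)
      then have le: "1 + \<alpha> * z / (\<alpha> + 1) \<le> 2 * z"
        using \<open>z \<ge> 1\<close> by linarith
      have "h_fun \<alpha> y0 / (\<alpha> * z * (2 * z)) \<le> h' z"
        unfolding h'_def
        using assms \<open>z > 0\<close> le that \<open>y0 > 0\<close>
        by (intro frac_le h_fun_mono h_fun_nonneg mult_left_mono mult_pos_pos add_pos_nonneg) auto
      then have "(z / 2) * (h_fun \<alpha> y0 / (\<alpha> * z * (2 * z))) \<le> (z - p) * h' z"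
        using \<open>z > 0\<close> \<open>z - p \<ge> z / 2\<close> assms h_fun_nonneg[of \<alpha> y0] by (intro mult_mono) auto
      moreover have "(z / 2) * (h_fun \<alpha> y0 / (\<alpha> * z * (2 * z))) = C / z"
        using \<open>z > 0\<close> assms by (simp add: C_def field_simps)
      ultimately show ?thesis
        by (simp add: algebra_simps)
    qed
    \<comment> \<open>Thus \<open>b_lhs\<close> falls at least as fast as \<open>- C * ln y\<close>,
      which is unbounded below.\<close>
    have bound: "b_lhs \<alpha> y + C * ln y \<le> b_lhs \<alpha> y0 + C * ln y0" if "y \<ge> y0" for y
    proof (rule DERIV_nonpos_imp_nonincreasing[OF that])
      fix z assume z: "y0 \<le> z" "z \<le> y"
      then have "z > 0"
        using \<open>y0 > 0\<close> by simp
      have "((\<lambda>y. b_lhs \<alpha> y + C * ln y) has_real_derivative (p - z) * h' z + C / z) (at z)"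
        using deriv[OF \<open>z > 0\<close>] \<open>z > 0\<close> by (auto intro!: derivative_eq_intros)
      then show "\<exists>d. ((\<lambda>y. b_lhs \<alpha> y + C * ln y) has_real_derivative d) (at z) \<and> d \<le> 0"
        using slope[OF z(1)] by force
    qed
    have "filterlim (\<lambda>y. C * ln y) at_top at_top"
      by (rule filterlim_tendsto_pos_mult_at_top[OF tendsto_const \<open>C > 0\<close> ln_at_top])
    then have "eventually (\<lambda>y. C * ln y > b_lhs \<alpha> y0 + C * ln y0) at_top"
      by (rule filterlim_at_top_dense[THEN iffD1, rule_format])
    then have "eventually (\<lambda>y. C * ln y > b_lhs \<alpha> y0 + C * ln y0 \<and> y \<ge> y0) at_top"
      by (intro eventually_conj eventually_ge_at_top)
    then obtain y where "C * ln y > b_lhs \<alpha> y0 + C * ln y0" "y \<ge> y0"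
      using eventually_happens trivial_limit_at_top_linorder by blast
    then show ?thesis
      using bound[of y] \<open>y0 > p\<close> by (intro exI[of _ y]) auto
  qed
  then obtain y1 where y1: "y1 > p" "b_lhs \<alpha> y1 < 0"
    by blast
  obtain b where b: "p \<le> b" "b \<le> y1" "b_lhs \<alpha> b = 0"
    using IVT2'[of "b_lhs \<alpha>" y1 0 p] y1 pos_p[of p] \<open>p > 0\<close> cont by force
  have "b \<noteq> p"
    using b pos_p[of p] \<open>p > 0\<close> by auto
  then have "b > p"
    using b by simp
  have less: "b_lhs \<alpha> y > 0" if "0 < y" "y < b" for y
    using pos_p[of y] dec[of y b] that b by (cases "y \<le> p") auto
  have "y = b" if "y > 0" "b_lhs \<alpha> y = 0" for y
    using less[of y] dec[of b y] \<open>b > p\<close> that b by (cases y b rule: linorder_cases) auto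
  then show thesis
    using that[of b] \<open>b > p\<close> b less by (auto simp: p_def)
qed

section \<open>The value recursion\<close>

locale nonneg_distribution = real_distribution D for D :: "real measure" +
  assumes integrable_id: "integrable D (\<lambda>x. x)"
    and AE_nonneg: "AE x in D. 0 \<le> x"
begin

text \<open>
  In the notation of the paper, \<open>V\<^sub>n\<^sup>1(x) = (q ^^ n) x\<close> and \<open>V\<^sub>n\<^sub>+\<^sub>1\<^sup>2 = v n\<close>. Since \<open>q\<close> is bounded by the
  mean, setting \<open>v 0\<close> to the mean makes the step from \<open>v 0\<close> to \<open>v 1\<close> an instance of the general one.
\<close>

definition q :: "real \<Rightarrow> real" where
  "q x = (\<integral>z. min z x \<partial>D)"

primrec v :: "nat \<Rightarrow> real" where
  "v 0 = (\<integral>z. z \<partial>D)"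
| "v (Suc k) = (\<integral>z. min ((q ^^ Suc k) z) (v k) \<partial>D)"

lemma prob_UNIV [simp]: "prob UNIV = 1"
  using prob_space by simp

lemma expectation_pos:
  fixes f :: "real \<Rightarrow> real"
  assumes "integrable D f" "AE x in D. 0 < f x"
  shows "0 < (\<integral>x. f x \<partial>D)"
  using integral_less_AE_space[of "\<lambda>_. 0" f] assms emeasure_space_1 by simp

lemma integrable_min_const: "integrable D f \<Longrightarrow> integrable D (\<lambda>z. min (f z) (x :: real))"
  by (intro integrable_min) auto

lemma q_mono: "x \<le> y \<Longrightarrow> q x \<le> q y"
  unfolding q_def by (intro integral_mono integrable_min_const integrable_id) auto

lemma q_le: "q x \<le> x"
  unfolding q_def by (rule integral_le_const) (auto intro: integrable_min_const integrable_id)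

lemma q_le_mean: "q x \<le> v 0"
  unfolding q_def v.simps by (intro integral_mono integrable_min_const integrable_id) auto

text \<open>For \<open>z \<ge> 0\<close> the value \<open>min z x\<close> is at least
  \<open>min 0 x\<close>. Valid on the whole line, the bound shows that \<open>q\<close> fixes 0 and
  dominates the iterates for integrability.\<close>

lemma abs_q_le: "\<bar>q x\<bar> \<le> \<bar>x\<bar>"
proof -
  have "- \<bar>x\<bar> \<le> q x"
    unfolding q_def
    by (rule integral_ge_const) (use AE_nonneg in \<open>auto intro!: integrable_min_const integrable_id elim!: eventually_mono\<close>)
  then show ?thesis
    using q_le[of x] by linarith
qed

lemma q_nonneg: "0 \<le> x \<Longrightarrow> 0 \<le> q x"
  using abs_q_le[of 0] q_mono[of 0 x] by simp

lemma iter_q_mono: "x \<le> y \<Longrightarrow> (q ^^ n) x \<le> (q ^^ n) y"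
  by (induction n) (auto intro: q_mono)

lemma iter_q_le: "(q ^^ n) x \<le> x"
  by (induction n) (auto intro: order_trans[OF q_le])

lemma abs_iter_q_le: "\<bar>(q ^^ n) x\<bar> \<le> \<bar>x\<bar>"
  by (induction n) (auto intro: order_trans[OF abs_q_le])

lemma iter_q_nonneg: "0 \<le> x \<Longrightarrow> 0 \<le> (q ^^ n) x"
  by (induction n) (auto intro: q_nonneg)

lemma iter_q_0: "(q ^^ n) 0 = 0"
  using abs_iter_q_le[of n 0] by simp

lemma borel_measurable_iter_q [measurable]: "(q ^^ n) \<in> borel_measurable borel"
  by (rule borel_measurable_mono) (auto intro: monoI iter_q_mono)

lemma integrable_iter_q: "integrable D (q ^^ n)"
  by (rule Bochner_Integration.integrable_bound[OF integrable_id])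
     (auto simp: abs_iter_q_le)

section \<open>Truncated means and threshold bounds for one step\<close>

definition partial_mean :: "(real \<Rightarrow> real) \<Rightarrow> real \<Rightarrow> real" where
  "partial_mean f x = (\<integral>z. f z * indicator {..x} z \<partial>D)"

lemma integrable_partial_mean: "integrable D f \<Longrightarrow> integrable D (\<lambda>z. f z * indicator {..x} z :: real)"
  by (rule integrable_real_mult_indicator) auto

lemma integral_indicator_atMost: "(\<integral>z. c * indicator {..x} z \<partial>D) = c * cdf D x"
  by (simp add: cdf_def)

text \<open>The difference is an integral over the points above \<open>a\<close> and at most
  \<open>b\<close>, where \<open>f\<close> lies between its end values. Partial means thus become
  comparable with Riemann sums.\<close>

lemma partial_mean_increment:
  assumes f: "integrable D f" "mono f" and "a \<le> b"
  shows "f a * (cdf D b - cdf D a) \<le> partial_mean f b - partial_mean f a"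
    and "partial_mean f b - partial_mean f a \<le> f b * (cdf D b - cdf D a)"
proof -
  have ind: "integrable D (\<lambda>z. c * indicator {..x} z :: real)" for c x
    by (intro integrable_mult_right integrable_real_indicator) (auto simp: emeasure_eq_measure)
  have diff: "partial_mean f b - partial_mean f a = (\<integral>z. f z * indicator {..b} z - f z * indicator {..a} z \<partial>D)"
    unfolding partial_mean_def by (simp add: integrable_partial_mean f)
  have cdf: "c * (cdf D b - cdf D a) = (\<integral>z. c * indicator {..b} z - c * indicator {..a} z \<partial>D)" for c
    unfolding Bochner_Integration.integral_diff[OF ind ind] integral_indicator_atMost
    by (simp add: algebra_simps)
  show "f a * (cdf D b - cdf D a) \<le> partial_mean f b - partial_mean f a"
    unfolding diff cdf
    by (intro integral_mono Bochner_Integration.integrable_diff ind integrable_partial_mean f)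
       (use \<open>a \<le> b\<close> monoD[OF f(2)] in \<open>auto simp: indicator_def\<close>)
  show "partial_mean f b - partial_mean f a \<le> f b * (cdf D b - cdf D a)"
    unfolding diff cdf
    by (intro integral_mono Bochner_Integration.integrable_diff ind integrable_partial_mean f)
       (use \<open>a \<le> b\<close> monoD[OF f(2)] in \<open>auto simp: indicator_def\<close>)
qed

text \<open>\<open>x - q x\<close> is the mean of the positive part of \<open>x - z\<close>, an
  antiderivative of the nondecreasing \<open>cdf D\<close>.\<close>

lemma q_defect_increment:
  assumes "a \<le> b"
  shows "(b - a) * cdf D a \<le> (b - q b) - (a - q a)"
    and "(b - q b) - (a - q a) \<le> (b - a) * cdf D b"
proof -
  have ind: "integrable D (\<lambda>z. c * indicator {..x} z :: real)" for c x
    by (intro integrable_mult_right integrable_real_indicator) (auto simp: emeasure_eq_measure)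
  have int: "integrable D (\<lambda>z. (b - min z b) - (a - min z a))"
    by (intro Bochner_Integration.integrable_diff integrable_min_const integrable_id) auto
  have "x - q x = (\<integral>z. x - min z x \<partial>D)" for x
    unfolding q_def using integrable_min_const[OF integrable_id, of x] by (simp)
  then have diff: "(b - q b) - (a - q a) = (\<integral>z. (b - min z b) - (a - min z a) \<partial>D)"
    using integrable_min_const[OF integrable_id] by (simp)
  show "(b - a) * cdf D a \<le> (b - q b) - (a - q a)"
    unfolding diff integral_indicator_atMost[symmetric]
    by (intro integral_mono ind int) (use assms in \<open>auto simp: indicator_def\<close>)
  show "(b - q b) - (a - q a) \<le> (b - a) * cdf D b"
    unfolding diff integral_indicator_atMost[symmetric]
    by (intro integral_mono ind int) (use assms in \<open>auto simp: indicator_def min_def\<close>)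
qed

lemma integrable_truncated_iter_q:
  "integrable D (\<lambda>z. (q ^^ n) z * indicator {..x} z + c * (1 - indicator {..x} z) :: real)"
  by (intro Bochner_Integration.integrable_add integrable_partial_mean integrable_iter_q
      integrable_mult_right Bochner_Integration.integrable_diff integrable_real_indicator integrable_const)
     (auto simp: emeasure_eq_measure)

lemma integral_truncated_iter_q:
  "(\<integral>z. (q ^^ n) z * indicator {..x} z + c * (1 - indicator {..x} z) \<partial>D)
    = partial_mean (q ^^ n) x + c * (1 - cdf D x)"
proof -
  have ind: "integrable D (\<lambda>z. indicator {..x} z :: real)"
    by (intro integrable_real_indicator) (auto simp: emeasure_eq_measure)
  then have "integrable D (\<lambda>z. 1 - indicator {..x} z :: real)"
    by simp
  then show ?thesis
    using ind integrable_partial_mean[OF integrable_iter_q, of n x]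
    by (simp add: partial_mean_def cdf_def)
qed

text \<open>The threshold rule \<open>x\<close> accepts exactly the observations
  \<open>z \<le> x\<close>, at cost \<open>(q ^^ Suc k) z\<close>, and otherwise pays
  \<open>v k\<close>; the pointwise minimum costs no more.\<close>

lemma v_Suc_le:
  "v (Suc k) \<le> partial_mean (q ^^ Suc k) x + v k * (1 - cdf D x)"
  unfolding v.simps integral_truncated_iter_q[symmetric]
  by (intro integral_mono integrable_truncated_iter_q integrable_min_const integrable_iter_q)
     (auto simp: indicator_def)

text \<open>Threshold \<open>x\<close> is optimal against the continuation value \<open>u\<close>,
  so the bracket is the mean of \<open>min ((q ^^ Suc k) z) u\<close>. This mean is concave and
  nondecreasing in \<open>u\<close> and vanishes at 0, so shrinking \<open>u\<close> to
  \<open>r * u\<close> loses at most the factor \<open>r\<close>.\<close>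

lemma v_Suc_ge:
  assumes "v k \<ge> 0" and u: "u = (q ^^ Suc k) x" "u > 0"
  shows "min (v k / u) 1 * (partial_mean (q ^^ Suc k) x + u * (1 - cdf D x)) \<le> v (Suc k)"
proof -
  \<comment> \<open>The largest factor up to 1 with \<open>r * u \<le> v k\<close>.\<close>
  define r where "r = min (v k / u) 1"
  have r: "0 \<le> r" "r \<le> 1" "r * u \<le> v k"
    using assms by (auto simp: r_def min_def field_simps)
  have "r * (\<integral>z. (q ^^ Suc k) z * indicator {..x} z + u * (1 - indicator {..x} z) \<partial>D)
      = (\<integral>z. r * ((q ^^ Suc k) z * indicator {..x} z + u * (1 - indicator {..x} z)) \<partial>D)"
    by simp
  also have "\<dots> \<le> (\<integral>z. min ((q ^^ Suc k) z) (v k) \<partial>D)"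
  proof (rule integral_mono_AE)
    show "AE z in D. r * ((q ^^ Suc k) z * indicator {..x} z + u * (1 - indicator {..x} z))
        \<le> min ((q ^^ Suc k) z) (v k)"
      using AE_nonneg
    proof eventually_elim
      case (elim z)
      show ?case
      proof (cases "z \<le> x")
        case True
        then have le: "(q ^^ Suc k) z \<le> u" and nn: "(q ^^ Suc k) z \<ge> 0"
          using iter_q_mono iter_q_nonneg[OF elim] by (auto simp: u simp del: funpow.simps)
        have "r * (q ^^ Suc k) z \<le> (q ^^ Suc k) z"
          using r nn by (intro mult_left_le_one_le)
        moreover have "r * (q ^^ Suc k) z \<le> v k"
          using mult_left_mono[OF le r(1)] r(3) by linarith
        ultimately show ?thesis
          using True by (simp del: funpow.simps)
      next
        case False
        then have ge: "(q ^^ Suc k) z \<ge> u"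
          using iter_q_mono[of x z] by (auto simp: u simp del: funpow.simps)
        have "r * u \<le> u"
          using r u by (intro mult_left_le_one_le) auto
        then show ?thesis
          using False ge r(3) by (simp del: funpow.simps)
      qed
    qed
  qed (intro integrable_mult_right integrable_truncated_iter_q integrable_min_const integrable_iter_q)+
  finally show ?thesis
    unfolding integral_truncated_iter_q r_def by simp
qed

end

section \<open>Asymptotics\<close>

text \<open>Mean value theorem with a monotone derivative. Differentiability is required only inside
  the interval, so \<open>a = 0\<close> is covered.\<close>

lemma powr_increment_bounds:
  fixes \<alpha> :: real
  assumes "\<alpha> > 0" "0 \<le> a" "a \<le> b"
  shows "a powr \<alpha> * (b - a) \<le> b powr (\<alpha> + 1) / (\<alpha> + 1) - a powr (\<alpha> + 1) / (\<alpha> + 1)"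
    and "b powr (\<alpha> + 1) / (\<alpha> + 1) - a powr (\<alpha> + 1) / (\<alpha> + 1) \<le> b powr \<alpha> * (b - a)"
proof -
  have "\<exists>z. a \<le> z \<and> z \<le> b \<and>
      b powr (\<alpha> + 1) / (\<alpha> + 1) - a powr (\<alpha> + 1) / (\<alpha> + 1) = (b - a) * z powr \<alpha>"
  proof (cases "a = b")
    case False
    then have "a < b"
      using assms by simp
    have der: "((\<lambda>x. x powr (\<alpha> + 1) / (\<alpha> + 1)) has_real_derivative x powr \<alpha>) (at x)" if "a < x" for x
      using DERIV_cdivide[OF has_real_derivative_powr[of x "\<alpha> + 1"], of "\<alpha> + 1"] assms that by simp
    have "\<exists>l z. a < z \<and> z < b \<and> ((\<lambda>x. x powr (\<alpha> + 1) / (\<alpha> + 1)) has_real_derivative l) (at z)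
        \<and> b powr (\<alpha> + 1) / (\<alpha> + 1) - a powr (\<alpha> + 1) / (\<alpha> + 1) = (b - a) * l"
    proof (rule MVT[OF \<open>a < b\<close>])
      show "continuous_on {a..b} (\<lambda>x. x powr (\<alpha> + 1) / (\<alpha> + 1))"
        by (intro continuous_intros continuous_on_powr') (use assms in auto)
      show "(\<lambda>x. x powr (\<alpha> + 1) / (\<alpha> + 1)) differentiable at x" if "a < x" for x
        using der[OF that] real_differentiable_def by blast
    qed
    then obtain l z where z: "a < z" "z < b" "((\<lambda>x. x powr (\<alpha> + 1) / (\<alpha> + 1)) has_real_derivative l) (at z)"
      "b powr (\<alpha> + 1) / (\<alpha> + 1) - a powr (\<alpha> + 1) / (\<alpha> + 1) = (b - a) * l"
      by blast
    then have "l = z powr \<alpha>"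
      using DERIV_unique der by blast
    then show ?thesis
      using z by (intro exI[of _ z]) auto
  qed auto
  then obtain z where z: "a \<le> z" "z \<le> b"
    "b powr (\<alpha> + 1) / (\<alpha> + 1) - a powr (\<alpha> + 1) / (\<alpha> + 1) = (b - a) * z powr \<alpha>"
    by blast
  have "a powr \<alpha> \<le> z powr \<alpha>" "z powr \<alpha> \<le> b powr \<alpha>"
    using assms z by (auto intro: powr_mono2)
  then show "a powr \<alpha> * (b - a) \<le> b powr (\<alpha> + 1) / (\<alpha> + 1) - a powr (\<alpha> + 1) / (\<alpha> + 1)"
    and "b powr (\<alpha> + 1) / (\<alpha> + 1) - a powr (\<alpha> + 1) / (\<alpha> + 1) \<le> b powr \<alpha> * (b - a)"
    unfolding z(3) using assms by (auto simp: mult.commute intro: mult_left_mono)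
qed

locale power_law_distribution = nonneg_distribution D for D +
  fixes L :: "real \<Rightarrow> real" and \<alpha> \<L> :: real
  assumes alpha_pos: "\<alpha> > 0"
    and scale_pos: "\<L> > 0"
    and cdf_eq: "\<And>x. x > 0 \<Longrightarrow> cdf D x = x powr \<alpha> * L x"
    and L_lim: "(L \<longlongrightarrow> \<L>) (at_right 0)"
begin

section \<open>Behaviour of the distribution function and of \<open>q\<close> near zero\<close>

lemma L_scaled_lim:
  assumes "filterlim f (at_right 0) Q"
  shows "((\<lambda>i. L (f i)) \<longlongrightarrow> \<L>) Q"
  using filterlim_compose[OF L_lim assms] .

text \<open>\<open>cdf_eq\<close> concerns positive arguments; right continuity carries the limit of
  \<open>x powr \<alpha> * L x\<close> over to 0. There is thus no atom at 0, which keeps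
  \<open>q\<close> and \<open>v\<close> strictly positive.\<close>

lemma cdf_0: "cdf D 0 = 0"
proof -
  have "((\<lambda>x. x powr \<alpha> * L x) \<longlongrightarrow> 0 * \<L>) (at_right 0)"
    by (intro tendsto_mult L_lim) (use alpha_pos in real_asymp)
  moreover have "eventually (\<lambda>x. x powr \<alpha> * L x = cdf D x) (at_right 0)"
    using eventually_at_right_less[of 0] by eventually_elim (simp add: cdf_eq)
  ultimately have "(cdf D \<longlongrightarrow> 0) (at_right 0)"
    using tendsto_cong by force
  moreover have "(cdf D \<longlongrightarrow> cdf D 0) (at_right 0)"
    using cdf_is_right_cont[of 0] by (simp add: continuous_within)
  ultimately show ?thesis
    using tendsto_unique trivial_limit_at_right_real by blast
qed

lemma AE_pos: "AE x in D. 0 < x"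
proof -
  have "AE x in D. x \<notin> {..0}"
    by (rule AE_not_in, rule null_setsI)
       (use cdf_0 in \<open>auto simp: cdf_def emeasure_eq_measure\<close>)
  then show ?thesis
    by eventually_elim auto
qed

lemma cdf_scaled_lim:
  assumes "u \<ge> 0" and f: "filterlim f (at_right 0) Q"
  shows "((\<lambda>i. cdf D (f i * u) / f i powr \<alpha>) \<longlongrightarrow> u powr \<alpha> * \<L>) Q"
proof (cases "u = 0")
  case False
  then have "u > 0"
    using assms by simp
  have ev: "eventually (\<lambda>i. f i > 0) Q"
    using f by (auto simp: filterlim_at elim: eventually_mono)
  have "((\<lambda>i. f i * u) \<longlongrightarrow> 0 * u) Q"
    by (intro tendsto_mult tendsto_const) (use f in \<open>simp add: filterlim_at\<close>)
  moreover have "eventually (\<lambda>i. f i * u \<in> {0<..} \<and> f i * u \<noteq> 0) Q"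
    using ev by eventually_elim (use \<open>u > 0\<close> in auto)
  ultimately have "filterlim (\<lambda>i. f i * u) (at_right 0) Q"
    by (simp add: filterlim_at)
  then have "((\<lambda>i. u powr \<alpha> * L (f i * u)) \<longlongrightarrow> u powr \<alpha> * \<L>) Q"
    by (intro tendsto_mult tendsto_const L_scaled_lim)
  moreover have "eventually (\<lambda>i. u powr \<alpha> * L (f i * u) = cdf D (f i * u) / f i powr \<alpha>) Q"
    using ev by eventually_elim (use \<open>u > 0\<close> in \<open>simp add: cdf_eq powr_mult\<close>)
  ultimately show ?thesis
    using tendsto_cong by force
qed (simp add: cdf_0)

text \<open>\<open>x - q x\<close> is the integral of the distribution function up to
  \<open>x\<close>, so the power law integrates. Rescaling to the interval from 0 to 1 brings it
  into the form of \<open>tendsto_of_increment_bounds\<close>.\<close>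

lemma q_defect_lim: "((\<lambda>x. (x - q x) / x powr (\<alpha> + 1)) \<longlongrightarrow> \<L> / (\<alpha> + 1)) (at_right 0)"
proof -
  define G where "G x u = (x * u - q (x * u)) / x powr (\<alpha> + 1)" for x u
  define F where "F x a = cdf D (x * a) / x powr \<alpha>" for x a
  have scale: "(x * b - x * a) * c / x powr (\<alpha> + 1) = (b - a) * (c / x powr \<alpha>)" if "x > 0" for a b c x :: real
    using that by (simp add: powr_add field_simps)
  have "((\<lambda>x. G x 1 - G x 0) \<longlongrightarrow>
      \<L> * (1 powr (\<alpha> + 1) / (\<alpha> + 1)) - \<L> * (0 powr (\<alpha> + 1) / (\<alpha> + 1))) (at_right 0)"
  proof (rule tendsto_of_increment_bounds[where h = "\<lambda>u. u powr \<alpha> * \<L>"])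
    fix a b :: real
    assume ab: "0 \<le> a" "a \<le> b" "b \<le> 1"
    show "\<forall>\<^sub>F x in at_right 0. (b - a) * F x a \<le> G x b - G x a"
      using eventually_at_right_less[of 0]
    proof eventually_elim
      case (elim x)
      have "(x * b - x * a) * cdf D (x * a) / x powr (\<alpha> + 1)
          \<le> ((x * b - q (x * b)) - (x * a - q (x * a))) / x powr (\<alpha> + 1)"
        by (intro divide_right_mono q_defect_increment mult_left_mono) (use ab elim in auto)
      then show ?case
        unfolding scale[OF elim] by (simp add: F_def G_def diff_divide_distrib)
    qed
    show "\<forall>\<^sub>F x in at_right 0. G x b - G x a \<le> (b - a) * F x b"
      using eventually_at_right_less[of 0]
    proof eventually_elim
      case (elim x)
      have "((x * b - q (x * b)) - (x * a - q (x * a))) / x powr (\<alpha> + 1)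
          \<le> (x * b - x * a) * cdf D (x * b) / x powr (\<alpha> + 1)"
        by (intro divide_right_mono q_defect_increment mult_left_mono) (use ab elim in auto)
      then show ?case
        unfolding scale[OF elim] by (simp add: F_def G_def diff_divide_distrib)
    qed
    have lim: "((\<lambda>x. (b - a) * F x c) \<longlongrightarrow> c powr \<alpha> * \<L> * (b - a)) (at_right 0)" if "c \<ge> 0" for c
      unfolding F_def mult.commute[of "_ * \<L>" "b - a"]
      by (intro tendsto_mult tendsto_const cdf_scaled_lim that filterlim_ident)
    show "((\<lambda>x. (b - a) * F x a) \<longlongrightarrow> a powr \<alpha> * \<L> * (b - a)) (at_right 0)"
      "((\<lambda>x. (b - a) * F x b) \<longlongrightarrow> b powr \<alpha> * \<L> * (b - a)) (at_right 0)"
      using lim ab by auto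
    show "a powr \<alpha> * \<L> * (b - a) \<le> \<L> * (b powr (\<alpha> + 1) / (\<alpha> + 1)) - \<L> * (a powr (\<alpha> + 1) / (\<alpha> + 1))"
      using mult_left_mono[OF powr_increment_bounds(1)[OF alpha_pos ab(1,2)], of \<L>] scale_pos
      by (simp add: algebra_simps)
    show "\<L> * (b powr (\<alpha> + 1) / (\<alpha> + 1)) - \<L> * (a powr (\<alpha> + 1) / (\<alpha> + 1)) \<le> b powr \<alpha> * \<L> * (b - a)"
      using mult_left_mono[OF powr_increment_bounds(2)[OF alpha_pos ab(1,2)], of \<L>] scale_pos
      by (simp add: algebra_simps)
  qed simp
  moreover have "q 0 = 0"
    using iter_q_0[of 1] by simp
  ultimately show ?thesis
    by (simp add: G_def)
qed

lemma q_pos: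
  assumes "x > 0"
  shows "q x > 0"
proof -
  have "0 < (\<integral>z. min z x \<partial>D)"
    by (rule expectation_pos)
       (use AE_pos assms in \<open>auto intro!: integrable_min_const integrable_id elim!: eventually_mono\<close>)
  then show ?thesis
    by (simp add: q_def)
qed

lemma iter_q_pos: "x > 0 \<Longrightarrow> (q ^^ n) x > 0"
  by (induction n) (auto intro: q_pos)

lemma v_pos: "v k > 0"
proof (induction k)
  case 0
  have "0 < (\<integral>z. z \<partial>D)"
    by (rule expectation_pos[OF integrable_id AE_pos])
  then show ?case
    by simp
next
  case (Suc k)
  have "0 < (\<integral>z. min ((q ^^ Suc k) z) (v k) \<partial>D)"
  proof (rule expectation_pos)
    show "AE z in D. 0 < min ((q ^^ Suc k) z) (v k)"
      using AE_pos by eventually_elim (use Suc iter_q_pos in \<open>auto simp del: funpow.simps\<close>)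
  qed (intro integrable_min_const integrable_iter_q)
  then show ?case
    by simp
qed

text \<open>The relative defect \<open>e x\<close> is asymptotic to
  \<open>\<L> * x powr \<alpha> / (\<alpha> + 1)\<close>, and
  \<open>(1 - e x) powr (- \<alpha>)\<close> is \<open>1 + \<alpha> * e x\<close> to first order. In
  the coordinate \<open>x powr (- \<alpha>)\<close>, \<open>q\<close> is asymptotically a
  translation.\<close>

lemma q_inverse_power_increment_lim:
  "((\<lambda>x. q x powr (- \<alpha>) - x powr (- \<alpha>)) \<longlongrightarrow> \<alpha> * \<L> / (\<alpha> + 1)) (at_right 0)"
proof -
  define e where "e x = (x - q x) / x" for x
  have e_lim: "((\<lambda>x. e x / x powr \<alpha>) \<longlongrightarrow> \<L> / (\<alpha> + 1)) (at_right 0)"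
  proof (rule tendsto_cong[THEN iffD1, OF _ q_defect_lim])
    show "\<forall>\<^sub>F x in at_right 0. (x - q x) / x powr (\<alpha> + 1) = e x / x powr \<alpha>"
      using eventually_at_right_less[of 0] by eventually_elim (simp add: e_def powr_add mult.commute)
  qed
  have "((\<lambda>x. e x / x powr \<alpha> * x powr \<alpha>) \<longlongrightarrow> \<L> / (\<alpha> + 1) * 0) (at_right 0)"
    by (intro tendsto_mult e_lim) (use alpha_pos in real_asymp)
  then have "(e \<longlongrightarrow> 0) (at_right 0)"
  proof (subst tendsto_cong)
    show "\<forall>\<^sub>F x in at_right 0. e x = e x / x powr \<alpha> * x powr \<alpha>"
      using eventually_at_right_less[of 0] by eventually_elim simp
  qed simp
  moreover have "\<forall>\<^sub>F x in at_right 0. 0 < e x / x powr \<alpha>"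
    by (rule order_tendstoD(1)[OF e_lim]) (use alpha_pos scale_pos in simp)
  then have e_pos: "\<forall>\<^sub>F x in at_right 0. 0 < e x"
    using eventually_at_right_less[of 0] by eventually_elim (simp add: zero_less_divide_iff)
  \<comment> \<open>The approach must be from the right, because the difference quotient below
    divides by \<open>e x\<close>.\<close>
  ultimately have "filterlim e (at_right 0) (at_right 0)"
    by (auto simp: filterlim_at elim!: eventually_mono)
  moreover have "((\<lambda>t. ((1 - t) powr (- \<alpha>) - 1) / t) \<longlongrightarrow> \<alpha>) (at_right 0)"
    using alpha_pos by real_asymp
  ultimately have "((\<lambda>x. ((1 - e x) powr (- \<alpha>) - 1) / e x) \<longlongrightarrow> \<alpha>) (at_right 0)"
    by (rule filterlim_compose[rotated])
  from tendsto_mult[OF this e_lim]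
  have "((\<lambda>x. ((1 - e x) powr (- \<alpha>) - 1) / e x * (e x / x powr \<alpha>)) \<longlongrightarrow> \<alpha> * (\<L> / (\<alpha> + 1))) (at_right 0)" .
  moreover have "\<forall>\<^sub>F x in at_right 0. ((1 - e x) powr (- \<alpha>) - 1) / e x * (e x / x powr \<alpha>)
      = q x powr (- \<alpha>) - x powr (- \<alpha>)"
    using e_pos eventually_at_right_less[of 0]
  proof eventually_elim
    case (elim x)
    have q: "q x = x * (1 - e x)" and "1 - e x > 0"
      using elim q_pos[of x] by (auto simp: e_def field_simps)
    then have "q x powr (- \<alpha>) = x powr (- \<alpha>) * (1 - e x) powr (- \<alpha>)"
      using elim by (simp add: powr_mult)
    then show ?case
      using elim by (simp add: powr_minus field_simps)
  qed
  ultimately show ?thesis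
    using tendsto_cong by force
qed

section \<open>The natural scale and the iterates of \<open>q\<close> on it\<close>

definition s :: "nat \<Rightarrow> real" where
  "s n = (\<L> * real n) powr (- (1 / \<alpha>))"

lemma s_pos: "n > 0 \<Longrightarrow> s n > 0"
  using scale_pos by (simp add: s_def)

text \<open>This normalization makes \<open>cdf D (s n)\<close> asymptotic to \<open>1 / n\<close>,
  and \<open>s n powr (- \<alpha>)\<close> of the same order as the total drift of \<open>n\<close>
  translations.\<close>

lemma s_powr:
  assumes "n > 0"
  shows "s n powr \<alpha> = 1 / (\<L> * real n)"
proof -
  have "s n powr \<alpha> = (\<L> * real n) powr (- 1)"
    using alpha_pos by (simp add: s_def powr_powr)
  then show ?thesis
    using assms scale_pos by (simp add: powr_neg_one)
qed

lemma s_lim: "filterlim s (at_right 0) sequentially"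
  unfolding s_def using alpha_pos scale_pos by real_asymp

text \<open>Passing from the unit \<open>s n\<close> to \<open>s (Suc n)\<close> contributes this
  rate; it is the source of \<open>1 / \<alpha>\<close> in the equation for
  \<open>b\<close>.\<close>

lemma s_ratio_lim: "(\<lambda>n. real n * (s n / s (Suc n) - 1)) \<longlonglongrightarrow> 1 / \<alpha>"
  unfolding s_def using alpha_pos scale_pos by real_asymp

lemma s_quotient_lim: "(\<lambda>n. s n / s (Suc n)) \<longlonglongrightarrow> 1"
  unfolding s_def using alpha_pos scale_pos by real_asymp

text \<open>In the coordinate \<open>x powr (- \<alpha>)\<close> the \<open>n\<close> iterations add
  \<open>n\<close> increments, all close to \<open>K\<close>. Dividing by
  \<open>s n powr (- \<alpha>) = \<L> * n\<close> leaves a translation by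
  \<open>K / \<L>\<close>.\<close>

lemma iter_q_lim_pos:
  assumes "z > 0"
  shows "(\<lambda>n. (q ^^ n) (z * s n) / s n) \<longlonglongrightarrow> (z powr (- \<alpha>) + \<alpha> / (\<alpha> + 1)) powr (- (1 / \<alpha>))"
proof -
  define K where "K = \<alpha> * \<L> / (\<alpha> + 1)"
  define Q where "Q x = q x powr (- \<alpha>) - x powr (- \<alpha>)" for x
  define T where "T n = (q ^^ n) (z * s n) powr (- \<alpha>) - (z * s n) powr (- \<alpha>)" for n
  have telescope: "(q ^^ n) x powr (- \<alpha>) - x powr (- \<alpha>) = (\<Sum>k<n. Q ((q ^^ k) x))" for n x
    by (induction n) (auto simp: Q_def)
  have "(\<lambda>n. T n / real n) \<longlonglongrightarrow> K"
  proof (rule tendstoI)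
    fix e :: real
    assume "e > 0"
    have "\<forall>\<^sub>F x in at_right 0. dist (Q x) K < e / 2"
      using tendstoD[OF q_inverse_power_increment_lim, of "e / 2"] \<open>e > 0\<close> by (simp add: Q_def K_def)
    then obtain \<delta> where \<delta>: "\<delta> > 0" "\<And>x. 0 < x \<Longrightarrow> x < \<delta> \<Longrightarrow> dist (Q x) K < e / 2"
      unfolding eventually_at_right[OF zero_less_one] by auto
    have "(s \<longlongrightarrow> 0) sequentially"
      using s_lim by (simp add: filterlim_at)
    then have "(\<lambda>n. z * s n) \<longlonglongrightarrow> z * 0"
      by (intro tendsto_mult tendsto_const)
    then have "\<forall>\<^sub>F n in sequentially. z * s n < \<delta>"
      by (rule order_tendstoD(2)) (use \<delta> in simp)
    then show "\<forall>\<^sub>F n in sequentially. dist (T n / real n) K < e"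
      using eventually_gt_at_top[of 0]
    proof eventually_elim
      case (elim n)
      have x_pos: "z * s n > 0"
        using assms s_pos elim by simp
      have "T n - real n * K = (\<Sum>k<n. Q ((q ^^ k) (z * s n)) - K)"
        by (simp add: T_def telescope sum_subtractf)
      also have "\<bar>\<dots>\<bar> \<le> (\<Sum>k<n. \<bar>Q ((q ^^ k) (z * s n)) - K\<bar>)"
        by (rule sum_abs)
      also have "\<dots> \<le> (\<Sum>k<n. e / 2)"
      proof (rule sum_mono)
        fix k
        \<comment> \<open>\<open>q x \<le> x\<close> keeps the whole orbit below its start, so the
          estimate of the increments is uniform in \<open>k\<close>.\<close>
        have "(q ^^ k) (z * s n) < \<delta>"
          using iter_q_le[of k "z * s n"] elim(1) by linarith
        then show "\<bar>Q ((q ^^ k) (z * s n)) - K\<bar> \<le> e / 2"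
          using \<delta>(2)[OF iter_q_pos[OF x_pos]] by (force simp: dist_real_def)
      qed
      finally have bound: "\<bar>T n - real n * K\<bar> \<le> real n * (e / 2)"
        by simp
      have "T n / real n - K = (T n - real n * K) / real n"
        using elim by (simp add: diff_divide_distrib)
      then have "dist (T n / real n) K = \<bar>T n - real n * K\<bar> / real n"
        by (simp add: dist_real_def)
      also have "\<dots> \<le> e / 2"
        using bound elim by (simp add: pos_divide_le_eq mult.commute)
      also have "\<dots> < e"
        using \<open>e > 0\<close> by simp
      finally show ?case .
    qed
  qed
  then have "(\<lambda>n. (z powr (- \<alpha>) + T n / real n / \<L>) powr (- (1 / \<alpha>)))
      \<longlonglongrightarrow> (z powr (- \<alpha>) + K / \<L>) powr (- (1 / \<alpha>))"
    by (intro tendsto_intros)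
       (use assms scale_pos alpha_pos add_pos_pos[of "z powr (- \<alpha>)" "K / \<L>"] in \<open>auto simp: K_def\<close>)
  moreover have "\<forall>\<^sub>F n in sequentially. (z powr (- \<alpha>) + T n / real n / \<L>) powr (- (1 / \<alpha>))
      = (q ^^ n) (z * s n) / s n"
    using eventually_gt_at_top[of 0]
  proof eventually_elim
    case (elim n)
    have pos: "s n > 0" "(q ^^ n) (z * s n) > 0"
      using s_pos[OF elim] iter_q_pos[of "z * s n"] assms by auto
    have s: "s n powr (- \<alpha>) = \<L> * real n"
      using s_powr[OF elim] scale_pos elim by (simp add: powr_minus)
    have "T n / real n / \<L> = T n / s n powr (- \<alpha>)"
      by (simp add: s mult.commute)
    also have "\<dots> = (q ^^ n) (z * s n) powr (- \<alpha>) / s n powr (- \<alpha>) - z powr (- \<alpha>)"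
      using assms pos unfolding T_def diff_divide_distrib by (simp add: powr_mult)
    finally have "z powr (- \<alpha>) + T n / real n / \<L> = ((q ^^ n) (z * s n) / s n) powr (- \<alpha>)"
      using pos by (simp add: powr_divide)
    then show ?case
      using pos alpha_pos by (simp add: powr_powr)
  qed
  ultimately have "(\<lambda>n. (q ^^ n) (z * s n) / s n) \<longlonglongrightarrow> (z powr (- \<alpha>) + K / \<L>) powr (- (1 / \<alpha>))"
    by (rule Lim_transform_eventually)
  moreover have "K / \<L> = \<alpha> / (\<alpha> + 1)"
    using scale_pos by (simp add: K_def)
  ultimately show ?thesis
    by simp
qed

text \<open>Thresholds are parametrized so that \<open>n * cdf D (level n u)\<close> tends to
  \<open>u\<close>, the variable of \<open>h_fun\<close>.\<close>

definition level :: "nat \<Rightarrow> real \<Rightarrow> real" where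
  "level n u = u powr (1 / \<alpha>) * s n"

lemma level_0 [simp]: "level n 0 = 0"
  by (simp add: level_def)

lemma level_mono: "0 \<le> a \<Longrightarrow> a \<le> b \<Longrightarrow> level n a \<le> level n b"
  using alpha_pos by (auto simp: level_def s_def intro!: mult_right_mono powr_mono2)

text \<open>Taking \<open>z = u powr (1 / \<alpha>)\<close> turns \<open>z powr (- \<alpha>)\<close>
  into \<open>1 / u\<close>; for \<open>u = 0\<close> the iterates fix 0.\<close>

lemma iter_q_level_lim:
  assumes "u \<ge> 0"
  shows "(\<lambda>n. (q ^^ n) (level n u) / s n) \<longlonglongrightarrow> h_fun \<alpha> u"
proof (cases "u = 0")
  case True
  then show ?thesis
    by (simp add: iter_q_0)
next
  case False
  then have "u > 0"
    using assms by simp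
  then have "(u powr (1 / \<alpha>)) powr (- \<alpha>) = 1 / u"
    using alpha_pos by (simp add: powr_powr powr_minus inverse_eq_divide)
  then show ?thesis
    using iter_q_lim_pos[of "u powr (1 / \<alpha>)"] \<open>u > 0\<close> alpha_pos
    by (simp add: h_fun_eq level_def)
qed

lemma cdf_level_lim:
  assumes "u \<ge> 0"
  shows "(\<lambda>n. real n * cdf D (level n u)) \<longlonglongrightarrow> u"
proof -
  have "(u powr (1 / \<alpha>)) powr \<alpha> * \<L> / \<L> = u"
    using assms alpha_pos scale_pos by (simp add: powr_powr)
  moreover have "(\<lambda>n. cdf D (s n * u powr (1 / \<alpha>)) / s n powr \<alpha> / \<L>) \<longlonglongrightarrow> (u powr (1 / \<alpha>)) powr \<alpha> * \<L> / \<L>"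
    by (intro tendsto_divide tendsto_const cdf_scaled_lim s_lim) (use scale_pos in auto)
  ultimately have "(\<lambda>n. cdf D (s n * u powr (1 / \<alpha>)) / s n powr \<alpha> / \<L>) \<longlonglongrightarrow> u"
    by simp
  then show ?thesis
  proof (rule Lim_transform_eventually)
    show "\<forall>\<^sub>F n in sequentially.
        cdf D (s n * u powr (1 / \<alpha>)) / s n powr \<alpha> / \<L> = real n * cdf D (level n u)"
      using eventually_gt_at_top[of 0]
      by eventually_elim (use scale_pos in \<open>simp add: s_powr level_def mult.commute\<close>)
  qed
qed

text \<open>In the variable \<open>u = n * cdf D x\<close>, \<open>n\<close> times the law becomes
  Lebesgue measure in the limit and \<open>(q ^^ n) x / s n\<close> becomes
  \<open>h_fun \<alpha> u\<close>.\<close>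

lemma partial_mean_level_lim:
  assumes "y \<ge> 0"
  shows "(\<lambda>n. real n * partial_mean (q ^^ n) (level n y) / s n) \<longlonglongrightarrow> integral {0..y} (h_fun \<alpha>)"
proof -
  define G where "G n u = real n * partial_mean (q ^^ n) (level n u) / s n" for n u
  define B where "B n c a b = (q ^^ n) (level n c) / s n * (real n * cdf D (level n b) - real n * cdf D (level n a))"
    for n c a b
  have "(\<lambda>n. G n y - G n 0) \<longlonglongrightarrow> integral {0..y} (h_fun \<alpha>) - integral {0..0} (h_fun \<alpha>)"
  proof (rule tendsto_of_increment_bounds[where lo = "\<lambda>n a b. B n a a b" and up = "\<lambda>n a b. B n b a b" and h = "h_fun \<alpha>"])
    fix a b
    assume ab: "0 \<le> a" "a \<le> b" "b \<le> y"
    have lim: "(\<lambda>n. B n c a b) \<longlonglongrightarrow> h_fun \<alpha> c * (b - a)" if "c \<ge> 0" for c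
      unfolding B_def by (intro tendsto_intros iter_q_level_lim cdf_level_lim) (use ab that in auto)
    show "(\<lambda>n. B n a a b) \<longlonglongrightarrow> h_fun \<alpha> a * (b - a)" "(\<lambda>n. B n b a b) \<longlonglongrightarrow> h_fun \<alpha> b * (b - a)"
      using lim ab by auto
    note inc = partial_mean_increment[OF integrable_iter_q _ level_mono[OF ab(1,2)]]
    have mono: "mono (q ^^ n)" for n
      by (auto intro: monoI iter_q_mono)
    have G_diff: "G n b - G n a = real n / s n *
        (partial_mean (q ^^ n) (level n b) - partial_mean (q ^^ n) (level n a))" for n
      by (simp add: G_def algebra_simps diff_divide_distrib)
    have B_eq: "B n c a b = real n / s n *
        ((q ^^ n) (level n c) * (cdf D (level n b) - cdf D (level n a)))" for n c
      by (simp add: B_def algebra_simps diff_divide_distrib)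
    show "\<forall>\<^sub>F n in sequentially. B n a a b \<le> G n b - G n a"
      unfolding G_diff B_eq
      by (intro always_eventually allI mult_left_mono inc mono) (simp add: s_def)
    show "\<forall>\<^sub>F n in sequentially. G n b - G n a \<le> B n b a b"
      unfolding G_diff B_eq
      by (intro always_eventually allI mult_left_mono inc mono) (simp add: s_def)
  qed (use assms alpha_pos integral_h_fun_increment in auto)
  \<comment> \<open>The base point contributes nothing, since \<open>D\<close> lives on the positive
    half line.\<close>
  moreover have "partial_mean (q ^^ n) 0 = 0" for n
  proof -
    have "partial_mean (q ^^ n) 0 = (\<integral>z. 0 \<partial>D)"
      unfolding partial_mean_def
    proof (rule integral_cong_AE)
      show "AE z in D. (q ^^ n) z * indicat_real {..0} z = 0"
        using AE_pos by eventually_elim auto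
    qed auto
    then show ?thesis
      by simp
  qed
  ultimately show ?thesis
    by (simp add: G_def)
qed

section \<open>Upper and lower bounds for the scaled value\<close>

text \<open>The threshold \<open>level n b\<close> yields a linear recursion in which
  \<open>c\<close> tends to \<open>b - 1 / \<alpha>\<close> and \<open>d\<close> to the integral of
  \<open>h_fun\<close> up to \<open>b\<close>. The equation for \<open>b\<close> says that its fixed
  point is \<open>h_fun \<alpha> b\<close>, and \<open>b > 1 / \<alpha>\<close> makes it
  contracting.\<close>

lemma scaled_v_eventually_le:
  assumes b: "b > 1 / \<alpha>" "b_lhs \<alpha> b = 0" and l: "l > h_fun \<alpha> b"
  shows "\<forall>\<^sub>F n in sequentially. v (n - 1) / s n \<le> l"
proof -
  define \<rho> where "\<rho> n = s n / s (Suc n)" for n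
  define P where "P n = cdf D (level n b)" for n
  define A where "A n = partial_mean (q ^^ n) (level n b)" for n
  \<comment> \<open>The first term, from the change of scale, tends to
    \<open>- (1 / \<alpha>)\<close>; the second, from the acceptance probability, to
    \<open>b\<close>.\<close>
  define c where "c n = real n * (1 - \<rho> n) + \<rho> n * (real n * P n)" for n
  define d where "d n = \<rho> n * (real n * A n / s n)" for n
  have "b > 0"
    using b(1) alpha_pos by (simp add: less_trans[OF _ b(1)])
  have \<rho>_lim: "\<rho> \<longlonglongrightarrow> 1"
    unfolding \<rho>_def by (rule s_quotient_lim)
  have c_lim: "c \<longlonglongrightarrow> - (1 / \<alpha>) + 1 * b"
  proof -
    have neg: "(\<lambda>n. - (real n * (\<rho> n - 1))) \<longlonglongrightarrow> - (1 / \<alpha>)"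
      unfolding \<rho>_def by (intro tendsto_minus s_ratio_lim)
    have "(\<lambda>n. - (real n * (\<rho> n - 1)) + \<rho> n * (real n * P n)) \<longlonglongrightarrow> - (1 / \<alpha>) + 1 * b"
      unfolding P_def by (intro tendsto_add[OF neg] tendsto_mult \<rho>_lim cdf_level_lim) (use \<open>b > 0\<close> in auto)
    moreover have "c = (\<lambda>n. - (real n * (\<rho> n - 1)) + \<rho> n * (real n * P n))"
      by (simp add: c_def fun_eq_iff algebra_simps)
    ultimately show ?thesis
      by simp
  qed
  have d_lim: "d \<longlonglongrightarrow> 1 * integral {0..b} (h_fun \<alpha>)"
    unfolding d_def A_def by (intro tendsto_mult \<rho>_lim partial_mean_level_lim) (use \<open>b > 0\<close> in auto)
  show ?thesis
  proof (rule eventually_le_of_contracting_recursion[OF _ c_lim d_lim])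
    show "\<forall>\<^sub>F n in sequentially. v (Suc n - 1) / s (Suc n) \<le> (1 - c n / real n) * (v (n - 1) / s n) + d n / real n"
      using eventually_gt_at_top[of 0]
    proof eventually_elim
      case (elim n)
      \<comment> \<open>Horizon \<open>n\<close> has the value \<open>v (n - 1) = v k\<close>, so
        \<open>v_Suc_le\<close> at \<open>k\<close> passes to horizon \<open>Suc n\<close> with the
        iterate \<open>q ^^ n\<close>.\<close>
      then obtain k where n: "n = Suc k"
        using gr0_conv_Suc by auto
      have "v n / s (Suc n) \<le> (A n + v (n - 1) * (1 - P n)) / s (Suc n)"
        using v_Suc_le[of k "level n b"] s_pos[of "Suc n"]
        by (intro divide_right_mono) (auto simp: A_def P_def n simp del: funpow.simps)
      also have "\<dots> = (1 - c n / real n) * (v (n - 1) / s n) + d n / real n"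
        using elim s_pos[of n] s_pos[of "Suc n"] by (simp add: c_def d_def \<rho>_def field_simps)
      finally show ?case
        by simp
    qed
    show "- (1 / \<alpha>) + 1 * b > 0"
      using b by simp
    have "integral {0..b} (h_fun \<alpha>) = (b - 1 / \<alpha>) * h_fun \<alpha> b"
      using b(2) by (simp add: b_lhs_def algebra_simps)
    then show "1 * integral {0..b} (h_fun \<alpha>) / (- (1 / \<alpha>) + 1 * b) < l"
      using b(1) l by simp
  qed
qed

text \<open>Apply \<open>v_Suc_ge\<close> at \<open>level n y\<close>, where \<open>u n\<close>
  tends to \<open>h_fun \<alpha> y > l\<close>. Below \<open>l\<close> the scaled value grows by the
  factor \<open>1 + c n / n\<close>, and \<open>c\<close> tends to
  \<open>b_lhs \<alpha> y / h_fun \<alpha> y\<close>.\<close>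

lemma scaled_v_eventually_ge:
  assumes y: "y > 0" "b_lhs \<alpha> y > 0" and l: "0 < l" "l < h_fun \<alpha> y"
  shows "\<forall>\<^sub>F n in sequentially. v (n - 1) / s n \<ge> l"
proof -
  define \<rho> where "\<rho> n = s n / s (Suc n)" for n
  define P where "P n = cdf D (level n y)" for n
  define A where "A n = partial_mean (q ^^ n) (level n y)" for n
  define u where "u n = (q ^^ n) (level n y) / s n" for n
  define c where "c n = real n * (\<rho> n - 1) + \<rho> n * ((real n * A n / s n) / u n - real n * P n)" for n
  have h_pos: "h_fun \<alpha> y > 0"
    using h_fun_pos alpha_pos y by simp
  have \<rho>_lim: "\<rho> \<longlonglongrightarrow> 1"
    unfolding \<rho>_def by (rule s_quotient_lim)
  have u_lim: "u \<longlonglongrightarrow> h_fun \<alpha> y"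
    unfolding u_def using iter_q_level_lim y by simp
  have c_lim: "c \<longlonglongrightarrow> 1 / \<alpha> + 1 * (integral {0..y} (h_fun \<alpha>) / h_fun \<alpha> y - y)"
    unfolding c_def \<rho>_def
    by (intro tendsto_add tendsto_mult[of _ 1] tendsto_diff tendsto_divide s_ratio_lim
        \<rho>_lim[unfolded \<rho>_def] u_lim)
       (use y h_pos partial_mean_level_lim cdf_level_lim in \<open>auto simp: A_def P_def\<close>)
  show ?thesis
  proof (rule eventually_ge_of_expanding_recursion[OF _ _ c_lim])
    have "\<forall>\<^sub>F n in sequentially. u n > l"
      by (rule order_tendstoD(1)[OF u_lim]) (use l in simp)
    then show "\<forall>\<^sub>F n in sequentially. min (v (n - 1) / s n) l * (1 + c n / real n) \<le> v (Suc n - 1) / s (Suc n)"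
      using eventually_gt_at_top[of 0]
    proof eventually_elim
      case (elim n)
      then obtain k where n: "n = Suc k"
        using gr0_conv_Suc by auto
      define w where "w = (q ^^ n) (level n y)"
      have pos: "s n > 0" "s (Suc n) > 0" "u n > 0"
        using elim s_pos l by auto
      then have "w > 0" and u_eq: "u n = w / s n"
        by (auto simp: u_def w_def zero_less_divide_iff)
      have fac: "\<rho> n * (1 - P n + A n / w) = 1 + c n / real n"
        using elim pos \<open>w > 0\<close> by (simp add: c_def u_eq field_simps)
      have A_nonneg: "A n \<ge> 0"
        unfolding A_def partial_mean_def
      proof (rule integral_nonneg_AE)
        show "AE z in D. 0 \<le> (q ^^ n) z * indicat_real {..level n y} z"
          using AE_nonneg by eventually_elim (auto intro!: mult_nonneg_nonneg iter_q_nonneg)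
      qed
      have "P n \<le> 1"
        by (simp add: P_def cdf_bounded_prob)
      \<comment> \<open>Nonnegativity of the factor permits replacing \<open>l\<close> by the larger
        \<open>u n\<close>.\<close>
      then have fac_nonneg: "1 + c n / real n \<ge> 0"
        unfolding fac[symmetric] \<rho>_def using pos A_nonneg \<open>w > 0\<close>
        by (intro mult_nonneg_nonneg add_nonneg_nonneg) auto
      have "min (v (n - 1) / s n) l * (1 + c n / real n) \<le> min (v (n - 1) / s n) (u n) * (1 + c n / real n)"
        using elim fac_nonneg by (intro mult_right_mono) auto
      also have "min (v (n - 1) / s n) (u n) = min (v (n - 1) / w) 1 * (w / s n)"
        using \<open>w > 0\<close> pos by (simp add: u_eq min_def field_simps)
      also have "min (v (n - 1) / w) 1 * (w / s n) * (1 + c n / real n)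
          = min (v (n - 1) / w) 1 * (A n + w * (1 - P n)) / s (Suc n)"
        unfolding fac[symmetric] using \<open>w > 0\<close> pos by (simp add: \<rho>_def field_simps)
      also have "\<dots> \<le> v n / s (Suc n)"
        using v_Suc_ge[of k w "level n y"] v_pos[of k] \<open>w > 0\<close> pos
        by (intro divide_right_mono) (auto simp: A_def P_def n w_def simp del: funpow.simps v.simps)
      finally show ?case
        by simp
    qed
    show "\<forall>\<^sub>F n in sequentially. 0 < v (n - 1) / s n"
      using eventually_gt_at_top[of 0] by eventually_elim (simp add: v_pos s_pos)
    have "1 / \<alpha> + 1 * (integral {0..y} (h_fun \<alpha>) / h_fun \<alpha> y - y) = b_lhs \<alpha> y / h_fun \<alpha> y"
      using h_pos by (simp add: b_lhs_def add_divide_distrib)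
    then show "1 / \<alpha> + 1 * (integral {0..y} (h_fun \<alpha>) / h_fun \<alpha> y - y) > 0"
      using y h_pos by simp
  qed fact
qed

text \<open>The scaled value is squeezed to \<open>h_fun \<alpha> b\<close>, from below through
  \<open>y < b\<close> close to \<open>b\<close>. The power law then gives the claim, as
  \<open>n * s n powr \<alpha> = 1 / \<L>\<close>.\<close>

theorem cdf_v_lim:
  assumes b: "b > 1 / \<alpha>" "b_lhs \<alpha> b = 0" "\<And>y. 0 < y \<Longrightarrow> y < b \<Longrightarrow> b_lhs \<alpha> y > 0"
  shows "(\<lambda>n. real n * cdf D (v (n - 1))) \<longlonglongrightarrow> h_fun \<alpha> b powr \<alpha>"
proof -
  have "b > 0"
    using b(1) alpha_pos by (simp add: less_trans[OF _ b(1)])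
  have h_pos: "h_fun \<alpha> b > 0"
    using h_fun_pos alpha_pos \<open>b > 0\<close> by simp
  define w where "w n = v (n - 1) / s n" for n
  have "w \<longlonglongrightarrow> h_fun \<alpha> b"
  proof (rule order_tendstoI)
    fix l
    assume "l > h_fun \<alpha> b"
    then obtain l' where "h_fun \<alpha> b < l'" "l' < l"
      using dense by blast
    from scaled_v_eventually_le[OF b(1,2) this(1)] show "\<forall>\<^sub>F n in sequentially. w n < l"
      unfolding w_def by eventually_elim (use \<open>l' < l\<close> in simp)
  next
    fix l
    assume "l < h_fun \<alpha> b"
    \<comment> \<open>The maximum with 0 provides the positive level demanded by
      \<open>scaled_v_eventually_ge\<close>.\<close>
    then obtain l' where l': "max l 0 < l'" "l' < h_fun \<alpha> b"
      using dense[of "max l 0" "h_fun \<alpha> b"] h_pos by auto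
    have "isCont (h_fun \<alpha>) b"
      using continuous_on_interior[OF continuous_on_h_fun[OF alpha_pos], of b] \<open>b > 0\<close> by simp
    then have "(h_fun \<alpha> \<longlongrightarrow> h_fun \<alpha> b) (at_left b)"
      by (simp add: continuous_at filterlim_at_split)
    then have "\<forall>\<^sub>F y in at_left b. h_fun \<alpha> y > l'"
      by (rule order_tendstoD(1)) (use l' in simp)
    moreover have "\<forall>\<^sub>F y in at_left b. y \<in> {0<..<b}"
      by (rule eventually_at_left_real) (use \<open>b > 0\<close> in simp)
    ultimately have "\<forall>\<^sub>F y in at_left b. h_fun \<alpha> y > l' \<and> y \<in> {0<..<b}"
      by (rule eventually_conj)
    then obtain y where y: "h_fun \<alpha> y > l'" "0 < y" "y < b"
      using eventually_happens trivial_limit_at_left_real by fastforce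
    have "\<forall>\<^sub>F n in sequentially. v (n - 1) / s n \<ge> l'"
      using scaled_v_eventually_ge[of y l'] b(3) y l' by simp
    then show "\<forall>\<^sub>F n in sequentially. w n > l"
      unfolding w_def by eventually_elim (use l' in simp)
  qed
  moreover have v_eq: "\<forall>\<^sub>F n in sequentially. w n * s n = v (n - 1)"
    using eventually_gt_at_top[of 0]
  proof eventually_elim
    case (elim n)
    then show ?case
      using s_pos[of n] by (simp add: w_def)
  qed
  ultimately have "(\<lambda>n. v (n - 1)) \<longlonglongrightarrow> h_fun \<alpha> b * 0"
    using s_lim by (intro Lim_transform_eventually[OF _ v_eq] tendsto_mult) (auto simp: filterlim_at)
  \<comment> \<open>Convergence from the right lets \<open>L_lim\<close> apply along
    \<open>v\<close>.\<close>
  then have v_lim: "filterlim (\<lambda>n. v (n - 1)) (at_right 0) sequentially"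
    by (simp add: filterlim_at v_pos less_imp_neq[OF v_pos, symmetric])
  have "(\<lambda>n. w n powr \<alpha> * L (v (n - 1)) / \<L>) \<longlonglongrightarrow> h_fun \<alpha> b powr \<alpha> * \<L> / \<L>"
    by (intro tendsto_intros L_scaled_lim v_lim \<open>w \<longlonglongrightarrow> h_fun \<alpha> b\<close>) (use h_pos scale_pos in auto)
  moreover have "\<forall>\<^sub>F n in sequentially. w n powr \<alpha> * L (v (n - 1)) / \<L> = real n * cdf D (v (n - 1))"
    using eventually_gt_at_top[of 0]
  proof eventually_elim
    case (elim n)
    then show ?case
      using v_pos[of "n - 1"] s_pos[of n] s_powr[of n] scale_pos
      by (simp add: w_def powr_divide cdf_eq)
  qed
  ultimately show ?thesis
    using scale_pos by (simp add: Lim_transform_eventually)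
qed

end

section \<open>The two choice value\<close>

lemma filtration_measurable_mono:
  assumes "filtration \<Omega> F" "i \<le> j" "f \<in> F i \<rightarrow>\<^sub>M N"
  shows "f \<in> F j \<rightarrow>\<^sub>M N"
  using assms filtration.sets_F_mono[OF assms(1,2)] filtration.space_F[OF assms(1)]
  by (auto simp: measurable_def)

text \<open>The value 0 stands for a choice not made by time \<open>t\<close>. The finite sum over
  decision times makes measurability at time \<open>t\<close> a termwise check.\<close>

definition stopped :: "(nat \<Rightarrow> 'a \<Rightarrow> real) \<Rightarrow> nat \<Rightarrow> ('a \<Rightarrow> nat) \<Rightarrow> nat \<Rightarrow> 'a \<Rightarrow> real" where
  "stopped X n \<sigma> t \<omega> = (\<Sum>r\<in>{1..t}. if \<sigma> \<omega> = r then X (n + 1 - r) \<omega> else 0)"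

lemma stopped_eq: "1 \<le> \<sigma> \<omega> \<Longrightarrow> \<sigma> \<omega> \<le> t \<Longrightarrow> stopped X n \<sigma> t \<omega> = X (n + 1 - \<sigma> \<omega>) \<omega>"
  by (simp add: stopped_def)

lemma abs_stopped_le:
  assumes "t \<le> n"
  shows "\<bar>stopped X n \<sigma> t \<omega>\<bar> \<le> (\<Sum>j\<in>{1..n}. \<bar>X j \<omega>\<bar>)"
proof (cases "1 \<le> \<sigma> \<omega> \<and> \<sigma> \<omega> \<le> t")
  case True
  have "\<bar>X (n + 1 - \<sigma> \<omega>) \<omega>\<bar> \<le> (\<Sum>j\<in>{1..n}. \<bar>X j \<omega>\<bar>)"
    by (rule member_le_sum) (use True assms in auto)
  then show ?thesis
    using True by (simp add: stopped_eq)
next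
  case False
  then have "stopped X n \<sigma> t \<omega> = 0"
    unfolding stopped_def by (intro sum.neutral) auto
  then show ?thesis
    by (simp add: sum_nonneg)
qed

lemma abs_min_le: "\<bar>a\<bar> \<le> c \<Longrightarrow> \<bar>b\<bar> \<le> c \<Longrightarrow> \<bar>min a b\<bar> \<le> (c :: real)"
  by (auto simp: min_def)

locale iid_observations = prob_space M + dist: nonneg_distribution D
  for M :: "'a measure" and D :: "real measure" +
  fixes X :: "nat \<Rightarrow> 'a \<Rightarrow> real"
  assumes indep: "indep_vars (\<lambda>_. borel) X {1..}"
    and distr_X: "\<And>i. i \<ge> 1 \<Longrightarrow> distr M borel (X i) = D"
begin

lemma X_measurable: "i \<ge> 1 \<Longrightarrow> X i \<in> borel_measurable M"
  using conjunct1[OF indep[unfolded indep_vars_def2]] by simp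

lemma integrable_X:
  assumes "i \<ge> 1"
  shows "integrable M (X i)"
  by (rule integrable_distr[OF X_measurable[OF assms], unfolded distr_X[OF assms], OF dist.integrable_id])

lemma integrable_of_bound:
  assumes "f \<in> borel_measurable M"
    and "\<And>\<omega>. \<omega> \<in> space M \<Longrightarrow> \<bar>f \<omega>\<bar> \<le> (\<Sum>j\<in>{1..n}. \<bar>X j \<omega>\<bar>) + c"
  shows "integrable M f"
proof (rule Bochner_Integration.integrable_bound[where f = "\<lambda>\<omega>. (\<Sum>j\<in>{1..n}. \<bar>X j \<omega>\<bar>) + c"])
  show "integrable M (\<lambda>\<omega>. (\<Sum>j\<in>{1..n}. \<bar>X j \<omega>\<bar>) + c)"
    by (intro Bochner_Integration.integrable_add Bochner_Integration.integrable_sum integrable_abs integrable_X) auto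
  show "AE \<omega> in M. norm (f \<omega>) \<le> norm ((\<Sum>j\<in>{1..n}. \<bar>X j \<omega>\<bar>) + c)"
    using assms(2) by (intro AE_I2) (fastforce intro: order_trans[OF _ abs_ge_self])
qed fact

section \<open>The past and the next observation\<close>

context
  fixes n :: nat
begin

abbreviation "F \<equiv> obs_filtration M X n"

lemmas filtration_F = filtration_obs_filtration[of M X n]

lemmas space_F = filtration.space_F[OF filtration_F]

text \<open>The generators are grouped by index, as \<open>indep_sets_collect_sigma\<close>
  requires.\<close>

lemma sets_F: "sets (F t) = sigma_sets (space M) (\<Union>j\<in>{n - t<..n}. {X j -` B \<inter> space M | B. B \<in> sets borel})"
proof -
  have "{X j -` B \<inter> space M | j B. j \<in> {n - t<..n} \<and> B \<in> sets borel}
      = (\<Union>j\<in>{n - t<..n}. {X j -` B \<inter> space M | B. B \<in> sets borel})"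
    by blast
  then show ?thesis
    unfolding obs_filtration_def by (subst sets_measure_of) auto
qed

lemma sets_F_subset: "sets (F t) \<subseteq> sets M"
  unfolding sets_F
  by (rule sets.sigma_sets_subset) (auto intro: measurable_sets[OF X_measurable])

lemma measurable_F_imp: "f \<in> F t \<rightarrow>\<^sub>M N \<Longrightarrow> f \<in> M \<rightarrow>\<^sub>M N"
  using sets_F_subset[of t] by (auto simp: measurable_def space_F)

lemma X_measurable_F:
  assumes "n - t < j" "j \<le> n"
  shows "X j \<in> borel_measurable (F t)"
proof (rule measurableI)
  fix B :: "real set"
  assume "B \<in> sets borel"
  then have "X j -` B \<inter> space M \<in> {X j -` B \<inter> space M | B. B \<in> sets borel}"
    by (intro CollectI exI[of _ B] conjI refl)
  moreover have "j \<in> {n - t<..n}"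
    using assms by simp
  ultimately have "X j -` B \<inter> space M \<in> (\<Union>j\<in>{n - t<..n}. {X j -` B \<inter> space M | B. B \<in> sets borel})"
    by (rule UN_I[rotated])
  then show "X j -` B \<inter> space (F t) \<in> sets (F t)"
    unfolding space_F sets_F by (rule sigma_sets.Basic)
qed (simp only: space_borel UNIV_I)

lemma pred_F_mono: "r \<le> t \<Longrightarrow> Measurable.pred (F r) P \<Longrightarrow> Measurable.pred (F t) P"
  by (rule filtration_measurable_mono[OF filtration_F])

lemma stopped_measurable_F:
  assumes "stopping_time F \<sigma>" "t \<le> n"
  shows "stopped X n \<sigma> t \<in> borel_measurable (F t)"
  unfolding stopped_def[abs_def]
proof (intro borel_measurable_sum measurable_If X_measurable_F borel_measurable_const)
  fix r assume "r \<in> {1..t}"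
  then show "{\<omega> \<in> space (F t). \<sigma> \<omega> = r} \<in> sets (F t)"
    by (intro predE pred_F_mono[OF _ filtration.stopping_time_eq_const[OF filtration_F assms(1)]]) simp
qed (use assms in auto)

text \<open>Pushing \<open>M\<close> forward along the identity restricts it to the past, which
  thereby becomes a random element with its own law.\<close>

lemma id_measurable_F: "(\<lambda>\<omega>. \<omega>) \<in> M \<rightarrow>\<^sub>M F t"
proof (rule measurableI)
  fix A
  assume A: "A \<in> sets (F t)"
  then have "(\<lambda>\<omega>. \<omega>) -` A \<inter> space M = A"
    using sets.sets_into_space[OF A] by (auto simp: space_F)
  then show "(\<lambda>\<omega>. \<omega>) -` A \<inter> space M \<in> sets M"
    using A sets_F_subset by auto
qed (simp only: space_F)

text \<open>Past and next observation are independent, so their joint law is a product and Fubini's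
  theorem integrates the latter with the past frozen.\<close>

lemma integral_next_observation:
  assumes "t < n" and G: "G \<in> borel_measurable (F t \<Otimes>\<^sub>M borel)"
    and int: "integrable M (\<lambda>\<omega>. G (\<omega>, X (n - t) \<omega>) :: real)"
  shows "(\<integral>\<omega>. G (\<omega>, X (n - t) \<omega>) \<partial>M) = (\<integral>\<omega>. (\<integral>z. G (\<omega>, z) \<partial>D) \<partial>M)"
proof -
  define E where "E j = {X j -` B \<inter> space M | B. B \<in> sets borel}" for j
  \<comment> \<open>Independence is regrouped into two blocks of indices: the past and the single
    next observation.\<close>
  define I where "I = case_bool {n - t<..n} {n - t}"
  have X_rv: "X (n - t) \<in> borel_measurable M"
    using assms(1) by (intro X_measurable) simp
  have "indep_sets (\<lambda>b. sigma_sets (space M) (\<Union>j\<in>I b. E j)) UNIV"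
  proof (rule indep_sets_collect_sigma)
    have "indep_sets E {1..}"
      using indep unfolding indep_vars_def2 E_def by simp
    then show "indep_sets E (\<Union>b\<in>UNIV. I b)"
      by (rule indep_sets_mono_index[rotated]) (use assms(1) in \<open>auto simp: I_def split: bool.splits\<close>)
    show "Int_stable (E j)" for j
      unfolding Int_stable_def E_def
    proof safe
      fix A B :: "real set"
      assume "A \<in> sets borel" "B \<in> sets borel"
      then show "\<exists>C. X j -` A \<inter> space M \<inter> (X j -` B \<inter> space M) = X j -` C \<inter> space M \<and> C \<in> sets borel"
        by (intro exI[of _ "A \<inter> B"]) auto
    qed
    show "disjoint_family_on I UNIV"
      by (auto simp: disjoint_family_on_def I_def split: bool.splits)
  qed
  moreover have "(\<lambda>b. sigma_sets (space M) (\<Union>j\<in>I b. E j)) = case_bool (sets (F t)) (sigma_sets (space M) (E (n - t)))"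
  proof
    show "sigma_sets (space M) (\<Union>j\<in>I b. E j) = case_bool (sets (F t)) (sigma_sets (space M) (E (n - t))) b" for b
      by (cases b) (simp_all only: I_def bool.case sets_F E_def UN_insert UN_empty Un_empty_right)
  qed
  ultimately have indep_next: "indep_set (sets (F t)) (sigma_sets (space M) (E (n - t)))"
    unfolding indep_set_def by (simp only:)
  interpret N: prob_space "distr M (F t) (\<lambda>\<omega>. \<omega>)"
    by (rule prob_space_distr[OF id_measurable_F])
  interpret P: pair_prob_space "distr M (F t) (\<lambda>\<omega>. \<omega>)" D ..
  have pair_rv: "(\<lambda>\<omega>. (\<omega>, X (n - t) \<omega>)) \<in> M \<rightarrow>\<^sub>M F t \<Otimes>\<^sub>M borel"
    by (rule measurable_Pair[OF id_measurable_F X_rv])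
  \<comment> \<open>It suffices to compare the measures on rectangles, where equality is
    independence.\<close>
  have joint: "distr M (F t) (\<lambda>\<omega>. \<omega>) \<Otimes>\<^sub>M D = distr M (F t \<Otimes>\<^sub>M borel) (\<lambda>\<omega>. (\<omega>, X (n - t) \<omega>))"
  proof (rule pair_measure_eqI)
    show "sigma_finite_measure (distr M (F t) (\<lambda>\<omega>. \<omega>))" "sigma_finite_measure D"
      by unfold_locales
    show "sets (distr M (F t) (\<lambda>\<omega>. \<omega>) \<Otimes>\<^sub>M D) = sets (distr M (F t \<Otimes>\<^sub>M borel) (\<lambda>\<omega>. (\<omega>, X (n - t) \<omega>)))"
      unfolding sets_distr by (rule sets_pair_measure_cong[OF sets_distr dist.events_eq_borel])
    fix A B
    assume "A \<in> sets (distr M (F t) (\<lambda>\<omega>. \<omega>))" "B \<in> sets D"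
    then have A: "A \<in> sets (F t)" and B: "B \<in> sets borel"
      unfolding sets_distr dist.events_eq_borel .
    have A_eq: "(\<lambda>\<omega>. \<omega>) -` A \<inter> space M = A"
      using sets.sets_into_space[OF A] unfolding space_F by blast
    let ?C = "X (n - t) -` B \<inter> space M"
    have "?C \<in> E (n - t)"
      unfolding E_def by (intro CollectI exI[of _ B] conjI refl B)
    then have "prob (A \<inter> ?C) = prob A * prob ?C"
      by (intro indep_setD[OF indep_next A] sigma_sets.Basic)
    then have "emeasure M (A \<inter> ?C) = emeasure M A * emeasure M ?C"
      unfolding emeasure_eq_measure by (simp only: ennreal_mult'' measure_nonneg)
    moreover have "(\<lambda>\<omega>. (\<omega>, X (n - t) \<omega>)) -` (A \<times> B) \<inter> space M = A \<inter> ?C"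
      using sets.sets_into_space[OF A] unfolding space_F by blast
    moreover have "emeasure D B = emeasure M ?C"
      using emeasure_distr[OF X_rv B] assms(1) by (simp only: distr_X Suc_leI One_nat_def zero_less_diff)
    ultimately show "emeasure (distr M (F t) (\<lambda>\<omega>. \<omega>)) A * emeasure D B
        = emeasure (distr M (F t \<Otimes>\<^sub>M borel) (\<lambda>\<omega>. (\<omega>, X (n - t) \<omega>))) (A \<times> B)"
      unfolding emeasure_distr[OF id_measurable_F A] emeasure_distr[OF pair_rv pair_measureI[OF A B]] A_eq
      by (simp only:)
  qed
  have "(\<integral>\<omega>. G (\<omega>, X (n - t) \<omega>) \<partial>M) = integral\<^sup>L (distr M (F t) (\<lambda>\<omega>. \<omega>) \<Otimes>\<^sub>M D) G"
    unfolding joint by (rule integral_distr[OF pair_rv G, symmetric])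
  also have "\<dots> = (\<integral>\<omega>. (\<integral>z. G (\<omega>, z) \<partial>D) \<partial>distr M (F t) (\<lambda>\<omega>. \<omega>))"
  proof (rule P.integral_fst'[symmetric])
    show "integrable (distr M (F t) (\<lambda>\<omega>. \<omega>) \<Otimes>\<^sub>M D) G"
      unfolding joint using int integrable_distr_eq[OF pair_rv G] by simp
  qed
  also have "\<dots> = (\<integral>\<omega>. (\<integral>z. G (\<omega>, z) \<partial>D) \<partial>M)"
  proof (rule integral_distr[OF id_measurable_F])
    have "G \<in> borel_measurable (F t \<Otimes>\<^sub>M D)"
      using G unfolding measurable_cong_sets[OF sets_pair_measure_cong[OF refl dist.events_eq_borel] refl] .
    moreover have "(\<lambda>(\<omega>, z). G (\<omega>, z)) = G"
      by (rule ext) (simp only: split_paired_all prod.case)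
    ultimately show "(\<lambda>\<omega>. \<integral>z. G (\<omega>, z) \<partial>D) \<in> borel_measurable (F t)"
      by (intro dist.borel_measurable_lebesgue_integral) (simp only:)
  qed
  finally show ?thesis .
qed

section \<open>Dynamic programming along a rule\<close>

lemma two_choice_rule_bounds:
  assumes "two_choice_rule M X n \<sigma> \<tau>" "\<omega> \<in> space M"
  shows "1 \<le> \<sigma> \<omega>" "\<sigma> \<omega> < \<tau> \<omega>" "\<tau> \<omega> \<le> n"
  using assms by (auto simp: two_choice_rule_def)

text \<open>
  \<open>cost \<sigma> \<tau> t\<close> is the optimal expected cost after time \<open>t\<close> of continuing what \<open>\<sigma>\<close> and \<open>\<tau>\<close> did up to \<open>t\<close>,
  and \<open>next_cost \<sigma> \<tau> t (\<omega>, z)\<close> is the cost after an optimal decision on the next observation \<open>z\<close>.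
\<close>

definition cost :: "('a \<Rightarrow> nat) \<Rightarrow> ('a \<Rightarrow> nat) \<Rightarrow> nat \<Rightarrow> 'a \<Rightarrow> real" where
  "cost \<sigma> \<tau> t \<omega> =
    (if \<tau> \<omega> \<le> t then min (stopped X n \<sigma> t \<omega>) (stopped X n \<tau> t \<omega>)
     else if \<sigma> \<omega> \<le> t then (dist.q ^^ (n - t)) (stopped X n \<sigma> t \<omega>)
     else dist.v (n - t - 1))"

definition next_cost :: "('a \<Rightarrow> nat) \<Rightarrow> ('a \<Rightarrow> nat) \<Rightarrow> nat \<Rightarrow> 'a \<times> real \<Rightarrow> real" where
  "next_cost \<sigma> \<tau> t = (\<lambda>(\<omega>, z).
    if \<tau> \<omega> \<le> t then min (stopped X n \<sigma> t \<omega>) (stopped X n \<tau> t \<omega>)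
    else if \<sigma> \<omega> \<le> t then min ((dist.q ^^ (n - t - 1)) (stopped X n \<sigma> t \<omega>)) z
    else min ((dist.q ^^ (n - t - 1)) z) (dist.v (n - t - 2)))"

context
  fixes \<sigma> \<tau> :: "'a \<Rightarrow> nat"
  assumes rule: "two_choice_rule M X n \<sigma> \<tau>"
begin

lemma stopping_times: "stopping_time F \<sigma>" "stopping_time F \<tau>"
  using rule by (auto simp: two_choice_rule_def)

lemma cost_measurable:
  assumes "t \<le> n"
  shows "cost \<sigma> \<tau> t \<in> borel_measurable (F t)"
proof -
  note [measurable] = stopped_measurable_F[OF stopping_times(1) assms]
    stopped_measurable_F[OF stopping_times(2) assms]
    stopping_timeD[OF stopping_times(1), of t] stopping_timeD[OF stopping_times(2), of t]
  show ?thesis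
    unfolding cost_def[abs_def] by measurable
qed

lemma next_cost_measurable:
  assumes "t \<le> n"
  shows "next_cost \<sigma> \<tau> t \<in> borel_measurable (F t \<Otimes>\<^sub>M borel)"
proof -
  note [measurable] = stopped_measurable_F[OF stopping_times(1) assms]
    stopped_measurable_F[OF stopping_times(2) assms]
    stopping_timeD[OF stopping_times(1), of t] stopping_timeD[OF stopping_times(2), of t]
  show ?thesis
    unfolding next_cost_def[abs_def] by measurable
qed

lemma integrable_cost:
  assumes "t \<le> n"
  shows "integrable M (cost \<sigma> \<tau> t)"
proof (rule integrable_of_bound)
  show "cost \<sigma> \<tau> t \<in> borel_measurable M"
    by (rule measurable_F_imp[OF cost_measurable[OF assms]])
  fix \<omega>
  let ?B = "\<Sum>j\<in>{1..n}. \<bar>X j \<omega>\<bar>"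
  let ?c = "?B + \<bar>dist.v (n - t - 1)\<bar>"
  have stopped: "\<bar>stopped X n \<sigma> t \<omega>\<bar> \<le> ?c" "\<bar>stopped X n \<tau> t \<omega>\<bar> \<le> ?c"
    by (rule order_trans[OF abs_stopped_le[OF assms]], simp)+
  have "\<bar>min (stopped X n \<sigma> t \<omega>) (stopped X n \<tau> t \<omega>)\<bar> \<le> ?c"
    by (rule abs_min_le[OF stopped])
  moreover have "\<bar>(dist.q ^^ (n - t)) (stopped X n \<sigma> t \<omega>)\<bar> \<le> ?c"
    by (rule order_trans[OF dist.abs_iter_q_le stopped(1)])
  moreover have "\<bar>dist.v (n - t - 1)\<bar> \<le> ?c"
    by (simp add: sum_nonneg)
  ultimately show "\<bar>cost \<sigma> \<tau> t \<omega>\<bar> \<le> ?c"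
    by (simp only: cost_def split: if_split) blast
qed

lemma integrable_next_cost:
  assumes "t < n"
  shows "integrable M (\<lambda>\<omega>. next_cost \<sigma> \<tau> t (\<omega>, X (n - t) \<omega>))"
proof (rule integrable_of_bound)
  have "(\<lambda>\<omega>. (\<omega>, X (n - t) \<omega>)) \<in> M \<rightarrow>\<^sub>M F t \<Otimes>\<^sub>M borel"
    using assms by (intro measurable_Pair id_measurable_F X_measurable) simp
  then show "(\<lambda>\<omega>. next_cost \<sigma> \<tau> t (\<omega>, X (n - t) \<omega>)) \<in> borel_measurable M"
    by (rule measurable_compose[OF _ next_cost_measurable]) (use assms in simp)
  fix \<omega>
  let ?B = "\<Sum>j\<in>{1..n}. \<bar>X j \<omega>\<bar>"
  let ?c = "?B + \<bar>dist.v (n - t - 2)\<bar>"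
  have stopped: "\<bar>stopped X n \<sigma> t \<omega>\<bar> \<le> ?c" "\<bar>stopped X n \<tau> t \<omega>\<bar> \<le> ?c"
    by (rule order_trans[OF abs_stopped_le[OF less_imp_le[OF assms]]], simp)+
  have "\<bar>X (n - t) \<omega>\<bar> \<le> ?B"
    by (rule member_le_sum[of "n - t" "{1..n}" "\<lambda>j. \<bar>X j \<omega>\<bar>"]) (use assms in auto)
  then have X: "\<bar>X (n - t) \<omega>\<bar> \<le> ?c"
    by simp
  have v: "\<bar>dist.v (n - t - 2)\<bar> \<le> ?c"
    by (simp add: sum_nonneg)
  have q: "\<bar>(dist.q ^^ k) x\<bar> \<le> ?c" if "\<bar>x\<bar> \<le> ?c" for k x
    by (rule order_trans[OF dist.abs_iter_q_le that])
  have "\<bar>min (stopped X n \<sigma> t \<omega>) (stopped X n \<tau> t \<omega>)\<bar> \<le> ?c"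
    by (rule abs_min_le[OF stopped])
  moreover have "\<bar>min ((dist.q ^^ (n - t - 1)) (stopped X n \<sigma> t \<omega>)) (X (n - t) \<omega>)\<bar> \<le> ?c"
    by (rule abs_min_le[OF q[OF stopped(1)] X])
  moreover have "\<bar>min ((dist.q ^^ (n - t - 1)) (X (n - t) \<omega>)) (dist.v (n - t - 2))\<bar> \<le> ?c"
    by (rule abs_min_le[OF q[OF X] v])
  ultimately show "\<bar>next_cost \<sigma> \<tau> t (\<omega>, X (n - t) \<omega>)\<bar> \<le> ?c"
    by (simp only: next_cost_def prod.case split: if_split) blast
qed

text \<open>The Bellman equation: with the past frozen, integrating over \<open>z\<close> applies
  \<open>q\<close> once more or performs one step of the recursion for \<open>v\<close>.\<close>

lemma expectation_next_cost:
  assumes "t < n"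
  shows "(\<integral>\<omega>. next_cost \<sigma> \<tau> t (\<omega>, X (n - t) \<omega>) \<partial>M) = (\<integral>\<omega>. cost \<sigma> \<tau> t \<omega> \<partial>M)"
proof -
  have "(\<integral>\<omega>. next_cost \<sigma> \<tau> t (\<omega>, X (n - t) \<omega>) \<partial>M) = (\<integral>\<omega>. (\<integral>z. next_cost \<sigma> \<tau> t (\<omega>, z) \<partial>D) \<partial>M)"
    using assms by (intro integral_next_observation integrable_next_cost next_cost_measurable) auto
  also have "\<dots> = (\<integral>\<omega>. cost \<sigma> \<tau> t \<omega> \<partial>M)"
  proof (rule Bochner_Integration.integral_cong[OF refl])
    fix \<omega>
    assume \<omega>: "\<omega> \<in> space M"
    note bounds = two_choice_rule_bounds[OF rule \<omega>]
    consider "\<tau> \<omega> \<le> t" | "\<sigma> \<omega> \<le> t" "t < \<tau> \<omega>" | "t < \<sigma> \<omega>"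
      by linarith
    then show "(\<integral>z. next_cost \<sigma> \<tau> t (\<omega>, z) \<partial>D) = cost \<sigma> \<tau> t \<omega>"
    proof cases
      case 1
      then show ?thesis
        by (simp add: next_cost_def cost_def)
    next
      case 2
      have "Suc (n - t - 1) = n - t"
        using assms by simp
      then have "(dist.q ^^ (n - t)) x = dist.q ((dist.q ^^ (n - t - 1)) x)" for x
        by (metis comp_apply funpow.simps(2))
      moreover have "(\<integral>z. min c z \<partial>D) = dist.q c" for c
        by (simp add: dist.q_def min.commute)
      ultimately show ?thesis
        using 2 by (simp add: next_cost_def cost_def)
    next
      case 3
      \<comment> \<open>Two choices are still to be made, so \<open>n - t \<ge> 2\<close> and the
        truncated subtraction is exact.\<close>
      then have "Suc (n - t - 2) = n - t - 1"
        using bounds by simp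
      then have "dist.v (n - t - 1) = (\<integral>z. min ((dist.q ^^ (n - t - 1)) z) (dist.v (n - t - 2)) \<partial>D)"
        by (metis dist.v.simps(2))
      then show ?thesis
        using 3 bounds by (simp add: next_cost_def cost_def)
    qed
  qed
  finally show ?thesis .
qed

text \<open>Any decision lands on one of the alternatives minimized in \<open>next_cost\<close>. If
  the second choice is made now, the first value itself replaces its iterate, which is no larger by
  \<open>iter_q_le\<close>.\<close>

lemma cost_Suc_ge:
  assumes "t < n" and \<omega>: "\<omega> \<in> space M"
  shows "next_cost \<sigma> \<tau> t (\<omega>, X (n - t) \<omega>) \<le> cost \<sigma> \<tau> (Suc t) \<omega>"
proof -
  note bounds = two_choice_rule_bounds[OF rule \<omega>]
  show ?thesis
    using bounds dist.iter_q_le[of "n - Suc t" "X (n + 1 - \<sigma> \<omega>) \<omega>"]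
    by (auto simp: cost_def next_cost_def stopped_eq min_le_iff_disj not_le less_Suc_eq_le le_Suc_eq)
qed

lemma cost_0: "cost \<sigma> \<tau> 0 \<omega> = dist.v (n - 1)" if "\<omega> \<in> space M"
  using two_choice_rule_bounds[OF rule that] by (simp add: cost_def)

lemma cost_final: "cost \<sigma> \<tau> n \<omega> = min (X (n + 1 - \<sigma> \<omega>) \<omega>) (X (n + 1 - \<tau> \<omega>) \<omega>)" if "\<omega> \<in> space M"
  using two_choice_rule_bounds[OF rule that] by (simp add: cost_def stopped_eq)

lemma expectation_cost_0: "(\<integral>\<omega>. cost \<sigma> \<tau> 0 \<omega> \<partial>M) = dist.v (n - 1)"
proof -
  have "(\<integral>\<omega>. cost \<sigma> \<tau> 0 \<omega> \<partial>M) = (\<integral>\<omega>. dist.v (n - 1) \<partial>M)"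
    by (rule Bochner_Integration.integral_cong) (auto simp: cost_0)
  then show ?thesis
    by (simp add: prob_space)
qed

lemma expectation_cost_final:
  "(\<integral>\<omega>. cost \<sigma> \<tau> n \<omega> \<partial>M) = (\<integral>\<omega>. min (X (n + 1 - \<sigma> \<omega>) \<omega>) (X (n + 1 - \<tau> \<omega>) \<omega>) \<partial>M)"
  by (rule Bochner_Integration.integral_cong) (auto simp: cost_final)

text \<open>The mean of \<open>cost\<close> is nondecreasing in \<open>t\<close>; it starts at
  \<open>v (n - 1)\<close> and ends at the payoff of the rule.\<close>

lemma two_choice_rule_lower_bound:
  "dist.v (n - 1) \<le> (\<integral>\<omega>. min (X (n + 1 - \<sigma> \<omega>) \<omega>) (X (n + 1 - \<tau> \<omega>) \<omega>) \<partial>M)"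
proof -
  have "dist.v (n - 1) \<le> (\<integral>\<omega>. cost \<sigma> \<tau> t \<omega> \<partial>M)" if "t \<le> n" for t
    using that
  proof (induction t)
    case (Suc t)
    then have "dist.v (n - 1) \<le> (\<integral>\<omega>. next_cost \<sigma> \<tau> t (\<omega>, X (n - t) \<omega>) \<partial>M)"
      by (simp add: expectation_next_cost)
    also have "\<dots> \<le> (\<integral>\<omega>. cost \<sigma> \<tau> (Suc t) \<omega> \<partial>M)"
      using Suc by (intro integral_mono integrable_next_cost integrable_cost cost_Suc_ge) auto
    finally show ?case .
  qed (simp add: expectation_cost_0)
  from this[of n] show ?thesis
    by (simp add: expectation_cost_final)
qed

lemma two_choice_rule_value_eq:
  assumes opt: "\<And>t \<omega>. t < n \<Longrightarrow> \<omega> \<in> space M \<Longrightarrow>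
    cost \<sigma> \<tau> (Suc t) \<omega> = next_cost \<sigma> \<tau> t (\<omega>, X (n - t) \<omega>)"
  shows "(\<integral>\<omega>. min (X (n + 1 - \<sigma> \<omega>) \<omega>) (X (n + 1 - \<tau> \<omega>) \<omega>) \<partial>M) = dist.v (n - 1)"
proof -
  have "(\<integral>\<omega>. cost \<sigma> \<tau> t \<omega> \<partial>M) = dist.v (n - 1)" if "t \<le> n" for t
    using that
  proof (induction t)
    case (Suc t)
    have "(\<integral>\<omega>. cost \<sigma> \<tau> (Suc t) \<omega> \<partial>M) = (\<integral>\<omega>. next_cost \<sigma> \<tau> t (\<omega>, X (n - t) \<omega>) \<partial>M)"
      using Suc by (intro Bochner_Integration.integral_cong refl opt) auto
    then show ?case
      using Suc by (simp add: expectation_next_cost)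
  qed (simp add: expectation_cost_0)
  from this[of n] show ?thesis
    by (simp add: expectation_cost_final)
qed

end

section \<open>The greedy rule\<close>

definition opt_first :: "'a \<Rightarrow> nat" where
  "opt_first \<omega> = (LEAST r. 1 \<le> r \<and>
     (n - 1 \<le> r \<or> (dist.q ^^ (n - r)) (X (n + 1 - r) \<omega>) \<le> dist.v (n - r - 1)))"

definition opt_second :: "'a \<Rightarrow> nat" where
  "opt_second \<omega> = (LEAST r. opt_first \<omega> < r \<and>
     (n \<le> r \<or> X (n + 1 - r) \<omega> \<le> (dist.q ^^ (n - r)) (X (n + 1 - opt_first \<omega>) \<omega>)))"

text \<open>Time \<open>n - 1\<close> always qualifies: acceptance is forced there so that a time
  remains for the second choice.\<close>

lemma opt_first_props:
  assumes "n \<ge> 2"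
  shows "1 \<le> opt_first \<omega>" "opt_first \<omega> \<le> n - 1"
    "opt_first \<omega> \<noteq> n - 1 \<Longrightarrow>
      (dist.q ^^ (n - opt_first \<omega>)) (X (n + 1 - opt_first \<omega>) \<omega>) \<le> dist.v (n - opt_first \<omega> - 1)"
    "\<And>r. 1 \<le> r \<Longrightarrow> r < opt_first \<omega> \<Longrightarrow> dist.v (n - r - 1) < (dist.q ^^ (n - r)) (X (n + 1 - r) \<omega>)"
proof -
  let ?P = "\<lambda>r. 1 \<le> r \<and> (n - 1 \<le> r \<or> (dist.q ^^ (n - r)) (X (n + 1 - r) \<omega>) \<le> dist.v (n - r - 1))"
  have ex: "?P (n - 1)"
    using assms by simp
  have P: "?P (opt_first \<omega>)"
    unfolding opt_first_def by (rule LeastI[of ?P, OF ex])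
  show le: "opt_first \<omega> \<le> n - 1"
    unfolding opt_first_def by (rule Least_le[of ?P, OF ex])
  show "1 \<le> opt_first \<omega>"
    using P by blast
  show "(dist.q ^^ (n - opt_first \<omega>)) (X (n + 1 - opt_first \<omega>) \<omega>) \<le> dist.v (n - opt_first \<omega> - 1)"
    if "opt_first \<omega> \<noteq> n - 1"
    using P le that by linarith
  show "dist.v (n - r - 1) < (dist.q ^^ (n - r)) (X (n + 1 - r) \<omega>)" if "1 \<le> r" "r < opt_first \<omega>" for r
    using not_less_Least[of r ?P] that unfolding opt_first_def[symmetric] by linarith
qed

lemma opt_second_props:
  assumes "n \<ge> 2"
  shows "opt_first \<omega> < opt_second \<omega>" "opt_second \<omega> \<le> n"
    "opt_second \<omega> \<noteq> n \<Longrightarrow>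
      X (n + 1 - opt_second \<omega>) \<omega> \<le> (dist.q ^^ (n - opt_second \<omega>)) (X (n + 1 - opt_first \<omega>) \<omega>)"
    "\<And>r. opt_first \<omega> < r \<Longrightarrow> r < opt_second \<omega> \<Longrightarrow>
      (dist.q ^^ (n - r)) (X (n + 1 - opt_first \<omega>) \<omega>) < X (n + 1 - r) \<omega>"
proof -
  let ?P = "\<lambda>r. opt_first \<omega> < r \<and> (n \<le> r \<or> X (n + 1 - r) \<omega> \<le> (dist.q ^^ (n - r)) (X (n + 1 - opt_first \<omega>) \<omega>))"
  have ex: "?P n"
    using assms opt_first_props(2)[OF assms, of \<omega>] by simp
  have P: "?P (opt_second \<omega>)"
    unfolding opt_second_def by (rule LeastI[of ?P, OF ex])
  show le: "opt_second \<omega> \<le> n"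
    unfolding opt_second_def by (rule Least_le[of ?P, OF ex])
  show "opt_first \<omega> < opt_second \<omega>"
    using P by blast
  show "X (n + 1 - opt_second \<omega>) \<omega> \<le> (dist.q ^^ (n - opt_second \<omega>)) (X (n + 1 - opt_first \<omega>) \<omega>)"
    if "opt_second \<omega> \<noteq> n"
    using P le that by linarith
  show "(dist.q ^^ (n - r)) (X (n + 1 - opt_first \<omega>) \<omega>) < X (n + 1 - r) \<omega>"
    if "opt_first \<omega> < r" "r < opt_second \<omega>" for r
    using not_less_Least[of r ?P] that unfolding opt_second_def[symmetric] by linarith
qed

lemma stopping_time_opt_first: "stopping_time F opt_first"
proof -
  let ?P = "\<lambda>r \<omega>. 1 \<le> r \<and> (n - 1 \<le> r \<or> (dist.q ^^ (n - r)) (X (n + 1 - r) \<omega>) \<le> dist.v (n - r - 1))"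
  have "stopping_time F (\<lambda>\<omega>. Inf {r. ?P r \<omega>})"
  proof (rule stopping_time_Inf_nat[OF filtration_F])
    fix r
    show "Measurable.pred (F r) (?P r)"
    proof (cases "1 \<le> r \<and> r < n - 1")
      case True
      then have [measurable]: "X (n + 1 - r) \<in> borel_measurable (F r)"
        by (intro X_measurable_F) auto
      have P_eq: "?P r = (\<lambda>\<omega>. (dist.q ^^ (n - r)) (X (n + 1 - r) \<omega>) \<le> dist.v (n - r - 1))"
        using True by (intro ext) simp
      show ?thesis
        unfolding P_eq by measurable
    next
      case False
      \<comment> \<open>For \<open>r = 0\<close> and for \<open>n - 1 \<le> r\<close> the predicate
        does not depend on the outcome.\<close>
      then have "?P r = (\<lambda>\<omega>. 1 \<le> r)"
        by (intro ext) linarith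
      then show ?thesis
        by simp
    qed
  next
    show "\<exists>r. ?P r \<omega>" for \<omega>
      by (intro exI[of _ "Suc n"] conjI disjI1) linarith+
  qed
  then show ?thesis
    unfolding opt_first_def[abs_def] Inf_nat_def mem_Collect_eq .
qed

lemma stopping_time_opt_second:
  assumes "n \<ge> 2"
  shows "stopping_time F opt_second"
proof -
  let ?P = "\<lambda>r \<omega>. opt_first \<omega> < r \<and>
    (n \<le> r \<or> X (n + 1 - r) \<omega> \<le> (dist.q ^^ (n - r)) (X (n + 1 - opt_first \<omega>) \<omega>))"
  have "stopping_time F (\<lambda>\<omega>. Inf {r. ?P r \<omega>})"
  proof (rule stopping_time_Inf_nat[OF filtration_F])
    fix r
    have lt [measurable]: "Measurable.pred (F r) (\<lambda>\<omega>. opt_first \<omega> < r)"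
      by (rule filtration.stopping_time_less_const[OF filtration_F stopping_time_opt_first])
    show "Measurable.pred (F r) (?P r)"
    proof (cases "1 \<le> r \<and> r < n")
      case True
      then have [measurable]: "X (n + 1 - r) \<in> borel_measurable (F r)"
        by (intro X_measurable_F) auto
      have [measurable]: "stopped X n opt_first r \<in> borel_measurable (F r)"
        using True by (intro stopped_measurable_F stopping_time_opt_first) auto
      have "\<not> n \<le> r"
        using True by simp
      \<comment> \<open>The index of the first chosen observation is random; \<open>stopped\<close>
        expresses its value in a form measurable at time \<open>r\<close>.\<close>
      moreover have "stopped X n opt_first r \<omega> = X (n + 1 - opt_first \<omega>) \<omega>" if "opt_first \<omega> < r" for \<omega>
        by (rule stopped_eq[of opt_first \<omega> r X n, OF opt_first_props(1)[OF assms] less_imp_le[OF that]])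
      ultimately have P_eq: "?P r = (\<lambda>\<omega>. opt_first \<omega> < r \<and>
          X (n + 1 - r) \<omega> \<le> (dist.q ^^ (n - r)) (stopped X n opt_first r \<omega>))"
        by (intro ext) metis
      show ?thesis
        unfolding P_eq by measurable
    next
      case False
      have "?P r \<omega> \<longleftrightarrow> opt_first \<omega> < r" for \<omega>
        using opt_first_props(1)[OF assms, of \<omega>] False by linarith
      then show ?thesis
        using lt by (simp only:)
    qed
  next
    show "\<exists>r. ?P r \<omega>" for \<omega>
      using opt_first_props(2)[OF assms, of \<omega>] assms by (intro exI[of _ n]) auto
  qed
  then show ?thesis
    unfolding opt_second_def[abs_def] Inf_nat_def mem_Collect_eq .
qed

lemma two_choice_rule_opt:
  assumes "n \<ge> 2"
  shows "two_choice_rule M X n opt_first opt_second"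
  unfolding two_choice_rule_def
  using assms stopping_time_opt_first stopping_time_opt_second opt_first_props(1) opt_second_props(1,2)
  by blast

text \<open>The greedy rule takes the cheaper alternative at every time; only the forced choices
  need an extra argument.\<close>

lemma cost_opt_Suc:
  assumes "n \<ge> 2" "t < n" and \<omega>: "\<omega> \<in> space M"
  shows "cost opt_first opt_second (Suc t) \<omega> = next_cost opt_first opt_second t (\<omega>, X (n - t) \<omega>)"
proof -
  note f = opt_first_props[OF assms(1), where \<omega> = \<omega>] and s = opt_second_props[OF assms(1), where \<omega> = \<omega>]
  let ?k = "n - Suc t"
  let ?S = "X (n + 1 - opt_first \<omega>) \<omega>"
  consider "opt_second \<omega> \<le> t" | "opt_second \<omega> = Suc t" | "opt_first \<omega> \<le> t" "Suc t < opt_second \<omega>"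
    | "opt_first \<omega> = Suc t" | "Suc t < opt_first \<omega>"
    using f(1,2) s(1,2) by linarith
  then show ?thesis
  proof cases
    case 1
    then show ?thesis
      using f(1) s(1) by (simp add: cost_def next_cost_def stopped_eq)
  next
    case 2
    \<comment> \<open>At the last time \<open>?k\<close> is 0. Earlier, acceptance puts the new
      value below the iterate and hence below \<open>?S\<close>, so it is both minima.\<close>
    have "min ((dist.q ^^ ?k) ?S) (X (n - t) \<omega>) = min ?S (X (n - t) \<omega>)"
    proof (cases "Suc t = n")
      case False
      then have "X (n - t) \<omega> \<le> (dist.q ^^ ?k) ?S"
        using s(3) 2 by simp
      then show ?thesis
        using dist.iter_q_le[of ?k ?S] by simp
    qed simp
    then show ?thesis
      using 2 f(1) s(1) by (simp add: cost_def next_cost_def stopped_eq)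
  next
    case 3
    then show ?thesis
      using f(1) s(4)[of "Suc t"] by (simp add: cost_def next_cost_def stopped_eq)
  next
    case 4
    \<comment> \<open>A forced first choice is still optimal, because \<open>v 0\<close> is the mean
      and bounds \<open>q\<close>.\<close>
    have "(dist.q ^^ ?k) (X (n - t) \<omega>) \<le> dist.v (n - t - 2)"
    proof (cases "Suc t = n - 1")
      case True
      then have "?k = 1" "n - t - 2 = 0"
        using assms by auto
      then show ?thesis
        using dist.q_le_mean by simp
    next
      case False
      then show ?thesis
        using f(3) 4 by (simp add: numeral_2_eq_2)
    qed
    then show ?thesis
      using 4 s(1) by (simp add: cost_def next_cost_def stopped_eq)
  next
    case 5
    then have "dist.v (n - t - 2) < (dist.q ^^ ?k) (X (n - t) \<omega>)"
      using f(4)[of "Suc t"] by (simp add: numeral_2_eq_2)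
    then show ?thesis
      using 5 s(1) by (simp add: cost_def next_cost_def numeral_2_eq_2)
  qed
qed

theorem two_choice_value_eq:
  assumes "n \<ge> 2"
  shows "two_choice_value M X n = dist.v (n - 1)"
  unfolding two_choice_value_def
proof (rule cInf_eq_minimum)
  have "(\<integral>\<omega>. min (X (n + 1 - opt_first \<omega>) \<omega>) (X (n + 1 - opt_second \<omega>) \<omega>) \<partial>M) = dist.v (n - 1)"
    using assms by (intro two_choice_rule_value_eq two_choice_rule_opt cost_opt_Suc)
  then show "dist.v (n - 1) \<in> {(\<integral>\<omega>. min (X (n + 1 - \<sigma> \<omega>) \<omega>) (X (n + 1 - \<tau> \<omega>) \<omega>) \<partial>M) | \<sigma> \<tau>.
      two_choice_rule M X n \<sigma> \<tau>}"
    using two_choice_rule_opt[OF assms] by force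
next
  fix x
  assume "x \<in> {(\<integral>\<omega>. min (X (n + 1 - \<sigma> \<omega>) \<omega>) (X (n + 1 - \<tau> \<omega>) \<omega>) \<partial>M) | \<sigma> \<tau>. two_choice_rule M X n \<sigma> \<tau>}"
  then show "dist.v (n - 1) \<le> x"
    using two_choice_rule_lower_bound by blast
qed

end

end

section \<open>The limit\<close>

theorem theorem1p1:
  fixes M :: "'a measure" and X :: "nat \<Rightarrow> 'a \<Rightarrow> real"
    and F L :: "real \<Rightarrow> real" and \<alpha> \<L> :: real
  assumes "prob_space M"
    and "\<alpha> > 0"
    and indep: "prob_space.indep_vars M (\<lambda>_. borel) X {1..}"
    and distr: "\<And>i x. i \<ge> 1 \<Longrightarrow> cdf (distr M borel (X i)) x = F x"
    and nonneg: "\<And>i. i \<ge> 1 \<Longrightarrow> AE \<omega> in M. 0 \<le> X i \<omega>"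
    and integrable: "\<And>i. i \<ge> 1 \<Longrightarrow> integrable M (X i)"
    and F_eq: "\<And>x. x > 0 \<Longrightarrow> F x = x powr \<alpha> * L x"
    and L_lim: "(L \<longlongrightarrow> \<L>) (at_right 0)"
    and "\<L> > 0"
  shows "\<exists>b. (b > 0 \<and> b_equation \<alpha> b \<and> (\<forall>y>0. b_equation \<alpha> y \<longrightarrow> y = b)) \<and>
             (\<lambda>n. real n * F (two_choice_value M X n)) \<longlonglongrightarrow> h_fun \<alpha> b powr \<alpha>"
proof -
  interpret M: prob_space M
    by fact
  define D where "D = distr M borel (X 1)"
  have X_rv: "X i \<in> borel_measurable M" if "i \<ge> 1" for i
    using integrable[OF that] by simp
  have real_distr: "real_distribution (distr M borel (X i))" if "i \<ge> 1" for i
    by (rule M.real_distribution_distr[OF X_rv[OF that]])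
  have cdf_D: "cdf D = F"
    unfolding D_def by (intro ext distr) simp
  \<comment> \<open>The distribution function determines the law, so all observations share
    \<open>D\<close>.\<close>
  have distr_eq: "distr M borel (X i) = D" if "i \<ge> 1" for i
  proof (rule cdf_unique[OF real_distr[OF that]])
    show "real_distribution D"
      unfolding D_def by (rule real_distr) simp
    show "cdf (distr M borel (X i)) = cdf D"
      unfolding cdf_D by (intro ext distr that)
  qed
  interpret D: power_law_distribution D L \<alpha> \<L>
  proof (intro power_law_distribution.intro nonneg_distribution.intro
      nonneg_distribution_axioms.intro power_law_distribution_axioms.intro)
    show "real_distribution D"
      unfolding D_def by (rule real_distr) simp
    show "integrable D (\<lambda>x. x)"
      unfolding D_def using integrable_distr_eq[OF X_rv, of 1 "\<lambda>x. x"] integrable[of 1] by simp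
    show "AE x in D. 0 \<le> x"
      unfolding D_def by (subst AE_distr_iff) (use X_rv nonneg in auto)
    show "cdf D x = x powr \<alpha> * L x" if "x > 0" for x
      using F_eq[OF that] by (simp add: cdf_D)
  qed fact+
  interpret obs: iid_observations M D X
    by (intro iid_observations.intro iid_observations_axioms.intro D.nonneg_distribution_axioms
        \<open>prob_space M\<close> indep distr_eq)
  obtain b where b: "b > 1 / \<alpha>" "b_lhs \<alpha> b = 0" "\<And>y. 0 < y \<Longrightarrow> y < b \<Longrightarrow> b_lhs \<alpha> y > 0"
    "\<And>y. y > 0 \<Longrightarrow> b_lhs \<alpha> y = 0 \<Longrightarrow> y = b"
    using b_equation_unique_root[OF \<open>\<alpha> > 0\<close>] by metis
  have b_equation_iff: "b_equation \<alpha> y \<longleftrightarrow> b_lhs \<alpha> y = 0" for y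
    by (simp add: b_equation_def b_lhs_def)
  have "(\<lambda>n. real n * cdf D (D.v (n - 1))) \<longlonglongrightarrow> h_fun \<alpha> b powr \<alpha>"
    by (rule D.cdf_v_lim) (fact b(1), fact b(2), rule b(3))
  \<comment> \<open>The identification with the infimum holds for \<open>n \<ge> 2\<close>, which
    suffices for the limit.\<close>
  moreover have "\<forall>\<^sub>F n in sequentially. real n * cdf D (D.v (n - 1)) = real n * F (two_choice_value M X n)"
    using eventually_ge_at_top[of 2] by eventually_elim (simp only: obs.two_choice_value_eq cdf_D)
  ultimately have "(\<lambda>n. real n * F (two_choice_value M X n)) \<longlonglongrightarrow> h_fun \<alpha> b powr \<alpha>"
    by (rule Lim_transform_eventually)
  moreover have "b > 0"
    using b(1) \<open>\<alpha> > 0\<close> by (simp add: less_trans[OF _ b(1)])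
  ultimately show ?thesis
    unfolding b_equation_iff using b(2,4) by (intro exI[of _ b] conjI allI impI)
qed

end
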